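(* Let $G$ be a finite group of Lie type over $\mathbb{F}_q$ ($q$ a power of a prime $p$) with Borel subgroup $B$ and Weyl group $W$ generated by simple reflections $s_1,\dots,s_r$, and let $\mathbb{F}$ be a field of characteristic $p$. For every composition $\alpha$ of $r+1$, the multiplicity of the simple $H_W(0)$-module $\mathbf C_\alpha$ among the composition factors of the $H_W(0)$-module $1_B^G$ is \[ \sum_{w\in W:\ D(w^{-1})=D(\alpha)}q^{\ell(w)}. \]
   Context: $1_B^G=\overline B\cdot\mathbb{F} G$ is the $\mathbb{F}$-span of the right cosets of $B$ in $G$, where for $H\subseteq G$, $\overline H=\sum_{h\in H}h$. The $0$-Hecke algebra $H_W(0)$ is generated by $T_1,\dots,T_r$ with $T_i^2=-T_i$ and the braid relations of $W$, $T_w$ defined via reduced words; it acts on $1_B^G$ by $T_w(\overline Bg)=\overline{BwB}\,g$ for $g\in G$, $w\in W$ (this comes from the Hecke algebra $\mathrm{End}_{\mathbb{Z} G}(\overline B\mathbb{Z} G)$ specialized at $q=0$ in $\mathbb{F}$). $D(w)=\{i:\ell(ws_i)<\ell(w)\}$. Compositions $\alpha$ of $r+1$ correspond to subsets $D(\alpha)\subseteq[r]$ via partial sums. $\mathbf C_\alpha$ is the one-dimensional $H_W(0)$-module on which $T_i$ acts by $-1$ if $i\in D(\alpha)$ and by $0$ otherwise. *)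

theory Defs
  imports "HOL-Algebra.Coset" "HOL-Algebra.Generated_Groups" "HOL-Computational_Algebra.Primes"
begin

text \<open>The torus T = B \<inter> N; the Weyl group W = N / T, whose elements are the
  right cosets of T in N (so BwB is a well-defined subset of G, namely B w B as a
  product of subsets).  Simple reflections are given by an indexing s 1, ..., s r.\<close>

definition torus :: "'a set \<Rightarrow> 'a set \<Rightarrow> 'a set" where
  "torus B N = B \<inter> N"

definition weyl :: "('a, 'b) monoid_scheme \<Rightarrow> 'a set \<Rightarrow> 'a set \<Rightarrow> 'a set set" where
  "weyl G B N = rcosets\<^bsub>G\<lparr>carrier := N\<rparr>\<^esub> (torus B N)"

definition wprod :: "('a, 'b) monoid_scheme \<Rightarrow> 'a set \<Rightarrow> (nat \<Rightarrow> 'a set) \<Rightarrow> nat list \<Rightarrow> 'a set" where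
  "wprod G T s is = foldr (\<lambda>i X. s i <#>\<^bsub>G\<^esub> X) is T"

definition wlen :: "('a, 'b) monoid_scheme \<Rightarrow> 'a set \<Rightarrow> (nat \<Rightarrow> 'a set) \<Rightarrow> nat \<Rightarrow> 'a set \<Rightarrow> nat" where
  "wlen G T s r w = (LEAST k. \<exists>is. length is = k \<and> set is \<subseteq> {1..r} \<and> wprod G T s is = w)"

definition descents :: "('a, 'b) monoid_scheme \<Rightarrow> 'a set \<Rightarrow> (nat \<Rightarrow> 'a set) \<Rightarrow> nat \<Rightarrow> 'a set \<Rightarrow> nat set" where
  "descents G T s r w = {i \<in> {1..r}. wlen G T s r (w <#>\<^bsub>G\<^esub> s i) < wlen G T s r w}"

definition split_BN_pair ::
  "('a, 'b) monoid_scheme \<Rightarrow> 'a set \<Rightarrow> 'a set \<Rightarrow> (nat \<Rightarrow> 'a set) \<Rightarrow> nat \<Rightarrow> nat \<Rightarrow> bool" where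
  "split_BN_pair G B N s r q \<longleftrightarrow>
     group G \<and> finite (carrier G) \<and>
     subgroup B G \<and> subgroup N G \<and>
     normal (torus B N) (G\<lparr>carrier := N\<rparr>) \<and>
     generate G (B \<union> N) = carrier G \<and>
     (\<forall>i\<in>{1..r}. s i \<in> weyl G B N \<and> s i \<noteq> torus B N \<and>
                  s i <#>\<^bsub>G\<^esub> s i = torus B N) \<and>
     inj_on s {1..r} \<and>
     (\<forall>w\<in>weyl G B N. \<exists>is. set is \<subseteq> {1..r} \<and> wprod G (torus B N) s is = w) \<and>
     (\<forall>i\<in>{1..r}. \<forall>w\<in>weyl G B N.
        s i <#>\<^bsub>G\<^esub> B <#>\<^bsub>G\<^esub> w \<subseteq>
          (B <#>\<^bsub>G\<^esub> w <#>\<^bsub>G\<^esub> B) \<union> (B <#>\<^bsub>G\<^esub> (s i <#>\<^bsub>G\<^esub> w) <#>\<^bsub>G\<^esub> B)) \<and>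
     (\<forall>i\<in>{1..r}. s i <#>\<^bsub>G\<^esub> B <#>\<^bsub>G\<^esub> s i \<noteq> B) \<and>
     (\<forall>i\<in>{1..r}. card (B <#>\<^bsub>G\<^esub> s i <#>\<^bsub>G\<^esub> B) = q * card B)"

text \<open>1_B^G is the F-span of the right cosets Bg; a vector is a coefficient function on
  right cosets of B, vanishing outside rcosets B.\<close>
definition permmod :: "('a, 'b) monoid_scheme \<Rightarrow> 'a set \<Rightarrow> ('a set \<Rightarrow> 'f::field) set" where
  "permmod G B = {v. \<forall>C. C \<notin> rcosets\<^bsub>G\<^esub> B \<longrightarrow> v C = 0}"

text \<open>T_w acts by T_w(\<bar>B g) = \<bar>(BwB) g = sum of the right cosets C of B contained in BwBg.\<close>
definition hecke_act ::
  "('a, 'b) monoid_scheme \<Rightarrow> 'a set \<Rightarrow> 'a set \<Rightarrow> ('a set \<Rightarrow> 'f::field) \<Rightarrow> ('a set \<Rightarrow> 'f)" where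
  "hecke_act G B w v = (\<lambda>C'. if C' \<in> rcosets\<^bsub>G\<^esub> B then
       (\<Sum>C\<in>rcosets\<^bsub>G\<^esub> B. if C' \<subseteq> B <#>\<^bsub>G\<^esub> w <#>\<^bsub>G\<^esub> B <#>\<^bsub>G\<^esub> C then v C else 0)
     else 0)"

definition lin_subspace :: "('c \<Rightarrow> 'f::field) set \<Rightarrow> bool" where
  "lin_subspace U \<longleftrightarrow> (\<lambda>_. 0) \<in> U \<and> (\<forall>x\<in>U. \<forall>y\<in>U. (\<lambda>C. x C + y C) \<in> U) \<and>
                       (\<forall>c. \<forall>x\<in>U. (\<lambda>C. c * x C) \<in> U)"

definition hsubmod ::
  "('a, 'b) monoid_scheme \<Rightarrow> 'a set \<Rightarrow> (nat \<Rightarrow> 'a set) \<Rightarrow> nat \<Rightarrow> ('a set \<Rightarrow> 'f::field) set \<Rightarrow> bool" where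
  "hsubmod G B s r U \<longleftrightarrow> lin_subspace U \<and> U \<subseteq> permmod G B \<and>
     (\<forall>i\<in>{1..r}. \<forall>v\<in>U. hecke_act G B (s i) v \<in> U)"

definition comp_series ::
  "('a, 'b) monoid_scheme \<Rightarrow> 'a set \<Rightarrow> (nat \<Rightarrow> 'a set) \<Rightarrow> nat \<Rightarrow> ('a set \<Rightarrow> 'f::field) set list \<Rightarrow> bool" where
  "comp_series G B s r Vs \<longleftrightarrow> Vs \<noteq> [] \<and>
     (\<forall>j<length Vs. hsubmod G B s r (Vs ! j)) \<and>
     Vs ! 0 = {\<lambda>_. 0} \<and> last Vs = permmod G B \<and>
     (\<forall>j. 0 < j \<and> j < length Vs \<longrightarrow>
        Vs ! (j - 1) \<subset> Vs ! j \<and>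
        (\<forall>U. hsubmod G B s r U \<and> Vs ! (j - 1) \<subseteq> U \<and> U \<subseteq> Vs ! j \<longrightarrow>
             U = Vs ! (j - 1) \<or> U = Vs ! j))"

text \<open>The factor V_j / V_{j-1} is isomorphic to C_D: it is one-dimensional and T_i acts
  on it by -1 if i \<in> D and by 0 otherwise.\<close>
definition factor_iso_C ::
  "('a, 'b) monoid_scheme \<Rightarrow> 'a set \<Rightarrow> (nat \<Rightarrow> 'a set) \<Rightarrow> nat \<Rightarrow> ('a set \<Rightarrow> 'f::field) set \<Rightarrow>
   ('a set \<Rightarrow> 'f) set \<Rightarrow> nat set \<Rightarrow> bool" where
  "factor_iso_C G B s r U V D \<longleftrightarrow>
     (\<exists>v\<in>V. v \<notin> U \<and> V = {(\<lambda>C. u C + c * v C) | u c. u \<in> U}) \<and>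
     (\<forall>i\<in>{1..r}. \<forall>v\<in>V.
        (\<lambda>C. hecke_act G B (s i) v C - (if i \<in> D then - 1 else 0) * v C) \<in> U)"

definition cf_mult ::
  "('a, 'b) monoid_scheme \<Rightarrow> 'a set \<Rightarrow> (nat \<Rightarrow> 'a set) \<Rightarrow> nat \<Rightarrow> ('a set \<Rightarrow> 'f::field) set list \<Rightarrow>
   nat set \<Rightarrow> nat" where
  "cf_mult G B s r Vs D = card {j. 0 < j \<and> j < length Vs \<and>
                                   factor_iso_C G B s r (Vs ! (j - 1)) (Vs ! j) D}"

definition is_composition :: "nat list \<Rightarrow> nat \<Rightarrow> bool" where
  "is_composition \<alpha> n \<longleftrightarrow> (\<forall>a\<in>set \<alpha>. 0 < a) \<and> sum_list \<alpha> = n"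

definition comp_descents :: "nat list \<Rightarrow> nat set" where
  "comp_descents \<alpha> = {sum_list (take k \<alpha>) | k. 1 \<le> k \<and> k < length \<alpha>}"

end

theory Submission
  imports Defs "HOL-Library.Function_Algebras" "HOL.Vector_Spaces"
begin

text \<open>
  The right cosets of \<open>B\<close> are the chambers of a building: the Bruhat decomposition gives a
  \<open>W\<close>-valued distance \<open>\<delta>\<close>, and \<open>T\<^sub>w\<close> sums a function over all chambers at distance \<open>w\<close>.
  If \<open>U \<subset> V\<close> are submodules and \<open>w\<close> has maximal length with \<open>T\<^sub>w V\<close> not contained in \<open>U\<close>,
  then \<open>T\<^sub>w V\<close> consists of common eigenvectors modulo \<open>U\<close>; so all composition factors are
  one-dimensional, of the form \<open>C\<^sub>D\<close>.  For \<open>J \<subseteq> [r]\<close> the operator \<open>\<Sum>\<^sub>u T\<^sub>u\<close>, with \<open>u\<close> ranging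
  over \<open>W\<^sub>J\<close>, sums over the cosets of \<open>B\<close> inside a coset of the parabolic subgroup \<open>P\<^sub>J\<close>.  Their
  number is congruent to 1 modulo \<open>p\<close>, so this operator is the projection onto the functions
  constant on the cosets of \<open>P\<^sub>J\<close>; it acts on \<open>C\<^sub>D\<close> as 1 if \<open>D \<inter> J = {}\<close> and as 0 otherwise.
  Comparing ranks, the number of factors \<open>C\<^sub>D\<close> with \<open>D \<inter> J = {}\<close> is the number of cosets of \<open>P\<^sub>J\<close>,
  which is the sum of \<open>q\<^bsup>\<ell>(w)\<^esup>\<close> over the minimal representatives \<open>w\<close> of the cosets of \<open>W\<^sub>J\<close>, that is,
  over those with \<open>D(w\<^bsup>-1\<^esup>) \<inter> J = {}\<close>.  Inclusion-exclusion over \<open>J\<close> finishes the proof.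
\<close>

section \<open>Groups generated by involutions\<close>

text \<open>\<open>W\<close> enters only as a group generated by finitely many involutions;
  exchange, deletion and the theory of parabolic subgroups are derived later from the
  building.\<close>

locale involution_generated = group W
  for W :: "('w, 'm) monoid_scheme" (structure) +
  fixes I :: "'i set" and s :: "'i \<Rightarrow> 'w"
  assumes finite_I: "finite I"
    and s_closed [simp, intro]: "i \<in> I \<Longrightarrow> s i \<in> carrier W"
    and s_square: "i \<in> I \<Longrightarrow> s i \<otimes> s i = \<one>"
    and generated: "w \<in> carrier W \<Longrightarrow> \<exists>ws. set ws \<subseteq> I \<and> foldr (\<lambda>i x. s i \<otimes> x) ws \<one> = w"
begin

definition word :: "'i list \<Rightarrow> 'w" where
  "word ws = foldr (\<lambda>i x. s i \<otimes> x) ws \<one>"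

definition para :: "'i set \<Rightarrow> 'w set" where
  "para J = {word ws |ws. set ws \<subseteq> J}"

text \<open>The alphabet \<open>J\<close> is a parameter so that length in the subgroup
  \<open>para J\<close> can be compared with length in \<open>W\<close>; \<open>ell_para\<close>
  shows that the two agree.\<close>

definition len :: "'i set \<Rightarrow> 'w \<Rightarrow> nat" where
  "len J w = (LEAST k. \<exists>ws. length ws = k \<and> set ws \<subseteq> J \<and> word ws = w)"

lemma word_simps [simp]: "word [] = \<one>" "word (i # ws) = s i \<otimes> word ws"
  by (simp_all add: word_def)

lemma word_closed [simp]: "set ws \<subseteq> I \<Longrightarrow> word ws \<in> carrier W"
  by (induction ws) auto

lemma word_append: "set ws \<subseteq> I \<Longrightarrow> set js \<subseteq> I \<Longrightarrow> word (ws @ js) = word ws \<otimes> word js"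
  by (induction ws) (auto simp: m_assoc)

lemma s_cancel [simp]: "i \<in> I \<Longrightarrow> w \<in> carrier W \<Longrightarrow> s i \<otimes> (s i \<otimes> w) = w"
  by (simp add: m_assoc [symmetric] s_square)

lemma s_inv [simp]: "i \<in> I \<Longrightarrow> inv (s i) = s i"
  by (simp add: inv_equality s_square)

lemma word_rev: "set ws \<subseteq> I \<Longrightarrow> word (rev ws) = inv (word ws)"
  by (induction ws) (auto simp: word_append inv_mult_group)

lemma para_I: "para I = carrier W"
  using generated by (fastforce simp: para_def word_def [symmetric])

lemma para_subset: "J \<subseteq> I \<Longrightarrow> para J \<subseteq> carrier W"
  by (auto simp: para_def)

lemma para_closed: "J \<subseteq> I \<Longrightarrow> w \<in> para J \<Longrightarrow> w \<in> carrier W"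
  using para_subset by blast

lemma one_in_para [simp]: "\<one> \<in> para J"
  unfolding para_def using word_simps(1) by (intro CollectI exI [of _ "[]"]) auto

lemma s_in_para: "J \<subseteq> I \<Longrightarrow> i \<in> J \<Longrightarrow> s i \<in> para J"
  unfolding para_def by (intro CollectI exI [of _ "[i]"]) auto

lemma para_mult:
  assumes "J \<subseteq> I" "u \<in> para J" "w \<in> para J"
  shows "u \<otimes> w \<in> para J"
proof -
  obtain us ws where "set us \<subseteq> J" "word us = u" "set ws \<subseteq> J" "word ws = w"
    using assms by (auto simp: para_def)
  then show ?thesis
    using assms(1) word_append [of us ws] unfolding para_def
    by (intro CollectI exI [of _ "us @ ws"]) auto
qed

lemma para_inv:
  assumes "J \<subseteq> I" "w \<in> para J"
  shows "inv w \<in> para J"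
proof -
  obtain ws where "set ws \<subseteq> J" "word ws = w"
    using assms by (auto simp: para_def)
  then show ?thesis
    using assms(1) word_rev [of ws] unfolding para_def
    by (intro CollectI exI [of _ "rev ws"]) auto
qed

lemma len_le: "set ws \<subseteq> J \<Longrightarrow> len J (word ws) \<le> length ws"
  unfolding len_def by (rule Least_le) blast

lemma len_word:
  assumes "w \<in> para J"
  obtains ws where "set ws \<subseteq> J" "word ws = w" "length ws = len J w"
proof -
  have "\<exists>k. \<exists>ws. length ws = k \<and> set ws \<subseteq> J \<and> word ws = w"
    using assms by (auto simp: para_def)
  then have "\<exists>ws. length ws = len J w \<and> set ws \<subseteq> J \<and> word ws = w"
    unfolding len_def by (rule LeastI_ex)
  then show ?thesis using that by blast
qed

lemma len_one [simp]: "len J \<one> = 0"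
  using len_le [of "[]" J] by simp

lemma len_eq_0: "w \<in> para J \<Longrightarrow> len J w = 0 \<longleftrightarrow> w = \<one>"
  by (metis len_one len_word length_0_conv word_simps(1))

lemma len_s_le: "i \<in> J \<Longrightarrow> w \<in> para J \<Longrightarrow> len J (s i \<otimes> w) \<le> Suc (len J w)"
  by (rule len_word [of w J]) (use len_le [of "i # ws" J for ws] in force)+

lemma len_s_ge: "J \<subseteq> I \<Longrightarrow> i \<in> J \<Longrightarrow> w \<in> para J \<Longrightarrow> len J w \<le> Suc (len J (s i \<otimes> w))"
  using len_s_le [of i J "s i \<otimes> w"] para_mult [of J "s i" w] s_in_para [of J i] para_closed [of J w]
    s_cancel [of i w] by (simp add: subset_iff)

lemma len_mult_s_le:
  assumes "i \<in> I" "w \<in> carrier W"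
  shows "len I (w \<otimes> s i) \<le> Suc (len I w)"
proof -
  obtain ws where "set ws \<subseteq> I" "word ws = w" "length ws = len I w"
    using assms para_I len_word [of w I] by blast
  then show ?thesis
    using len_le [of "ws @ [i]" I] assms by (simp add: word_append)
qed

lemma len_split_left:
  assumes "J \<subseteq> I" "w \<in> para J" "w \<noteq> \<one>"
  obtains i u where "i \<in> J" "u \<in> para J" "w = s i \<otimes> u" "len J w = Suc (len J u)"
proof -
  obtain ws where ws: "set ws \<subseteq> J" "word ws = w" "length ws = len J w"
    using assms(2) by (rule len_word)
  with assms(3) obtain i js where js: "ws = i # js" by (cases ws) auto
  have u: "word js \<in> para J" using ws js by (auto simp: para_def)
  have "len J (word js) \<le> length js" using ws js by (intro len_le) auto
  moreover have "len J w \<le> Suc (len J (word js))"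
    using ws js u len_s_le by auto
  ultimately show ?thesis using ws js u by (intro that [of i "word js"]) auto
qed

lemma len_split_right:
  assumes "w \<in> carrier W" "w \<noteq> \<one>"
  obtains i u where "i \<in> I" "u \<in> carrier W" "w = u \<otimes> s i" "len I w = Suc (len I u)"
proof -
  obtain ws where ws: "set ws \<subseteq> I" "word ws = w" "length ws = len I w"
    using assms(1) para_I len_word [of w I] by blast
  with assms(2) obtain i js where js: "ws = js @ [i]" by (cases ws rule: rev_cases) auto
  have w: "w = word js \<otimes> s i" "i \<in> I" "set js \<subseteq> I" using ws js by (auto simp: word_append)
  then have "len I w \<le> Suc (len I (word js))" using len_mult_s_le by simp
  moreover have "len I (word js) \<le> length js" using w by (intro len_le)
  ultimately show ?thesis using ws js w by (intro that [of i "word js"]) auto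
qed

lemma len_inv_le:
  assumes "w \<in> carrier W" shows "len I (inv w) \<le> len I w"
proof -
  obtain ws where "set ws \<subseteq> I" "word ws = w" "length ws = len I w"
    using assms para_I len_word [of w I] by blast
  then show ?thesis using len_le [of "rev ws" I] by (simp add: word_rev)
qed

lemma len_inv: "w \<in> carrier W \<Longrightarrow> len I (inv w) = len I w"
  using len_inv_le [of w] len_inv_le [of "inv w"] by simp

end

section \<open>Buildings as chamber systems with a Weyl distance\<close>

text \<open>A step multiplies the distance on the left, because for cosets the distance from
  \<open>B g\<close> to \<open>B g'\<close> is the cell of \<open>g' g^-1\<close>. In
  \<open>panel_card\<close> the chamber \<open>y\<close> itself is not counted, so a panel has
  \<open>q + 1\<close> chambers.\<close>

locale building = involution_generated W I s
  for W :: "('w, 'm) monoid_scheme" (structure) and I :: "'i set" and s :: "'i \<Rightarrow> 'w" +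
  fixes \<Omega> :: "'c set" and \<delta> :: "'c \<Rightarrow> 'c \<Rightarrow> 'w" and q :: nat
  assumes finite_chambers: "finite \<Omega>" and chambers_nonempty: "\<Omega> \<noteq> {}"
    and s_ne_one: "i \<in> I \<Longrightarrow> s i \<noteq> \<one>"
    and dist_closed [simp, intro]: "x \<in> \<Omega> \<Longrightarrow> y \<in> \<Omega> \<Longrightarrow> \<delta> x y \<in> carrier W"
    and dist_one: "x \<in> \<Omega> \<Longrightarrow> y \<in> \<Omega> \<Longrightarrow> \<delta> x y = \<one> \<longleftrightarrow> x = y"
    and dist_inv: "x \<in> \<Omega> \<Longrightarrow> y \<in> \<Omega> \<Longrightarrow> \<delta> y x = inv (\<delta> x y)"
    and dist_step: "x \<in> \<Omega> \<Longrightarrow> y \<in> \<Omega> \<Longrightarrow> z \<in> \<Omega> \<Longrightarrow> i \<in> I \<Longrightarrow> \<delta> y z = s i \<Longrightarrow>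
                      \<delta> x z = \<delta> x y \<or> \<delta> x z = s i \<otimes> \<delta> x y"
    and dist_reach: "x \<in> \<Omega> \<Longrightarrow> y \<in> \<Omega> \<Longrightarrow> i \<in> I \<Longrightarrow>
                      \<exists>z\<in>\<Omega>. \<delta> y z = s i \<and> \<delta> x z = s i \<otimes> \<delta> x y"
    and panel_card: "y \<in> \<Omega> \<Longrightarrow> i \<in> I \<Longrightarrow> card {z \<in> \<Omega>. \<delta> y z = s i} = q"
    and thick: "2 \<le> q"
begin

abbreviation ell :: "'w \<Rightarrow> nat" where "ell \<equiv> len I"

lemma s_mult_ne: "i \<in> I \<Longrightarrow> w \<in> carrier W \<Longrightarrow> s i \<otimes> w \<noteq> w"
  using s_ne_one r_cancel_one [of w "s i"] by auto

lemma dist_sym: "x \<in> \<Omega> \<Longrightarrow> y \<in> \<Omega> \<Longrightarrow> i \<in> I \<Longrightarrow> \<delta> x y = s i \<Longrightarrow> \<delta> y x = s i"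
  using dist_inv [of x y] by simp

lemma dist_step_left:
  assumes "x \<in> \<Omega>" "x' \<in> \<Omega>" "y \<in> \<Omega>" "i \<in> I" "\<delta> x x' = s i"
  shows "\<delta> x' y = \<delta> x y \<or> \<delta> x' y = \<delta> x y \<otimes> s i"
proof -
  have "\<delta> y x' = \<delta> y x \<or> \<delta> y x' = s i \<otimes> \<delta> y x"
    using assms by (intro dist_step)
  then have "inv (\<delta> y x') = inv (\<delta> y x) \<or> inv (\<delta> y x') = inv (s i \<otimes> \<delta> y x)"
    by metis
  then show ?thesis
    using assms dist_inv [of y x] dist_inv [of y x'] by (simp add: inv_mult_group)
qed

lemma dist_reach_left:
  assumes "x \<in> \<Omega>" "y \<in> \<Omega>" "i \<in> I"
  obtains x' where "x' \<in> \<Omega>" "\<delta> x x' = s i" "\<delta> x' y = \<delta> x y \<otimes> s i"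
proof -
  obtain x' where x': "x' \<in> \<Omega>" "\<delta> x x' = s i" "\<delta> y x' = s i \<otimes> \<delta> y x"
    using dist_reach [of y x i] assms by blast
  then show ?thesis
    using assms that [of x'] dist_inv [of y x] dist_inv [of y x'] by (simp add: inv_mult_group)
qed

text \<open>A panel has \<open>q + 1 \<ge> 3\<close> chambers, so two distinct ones leave a third.
  This third chamber drives \<open>ell_s_ne\<close> and \<open>folding\<close>.\<close>

lemma other_neighbour:
  assumes "x \<in> \<Omega>" "y \<in> \<Omega>" "i \<in> I" "\<delta> y x = s i"
  obtains z where "z \<in> \<Omega>" "\<delta> y z = s i" "\<delta> x z = s i"
proof -
  have "\<not> card {z \<in> \<Omega>. \<delta> y z = s i} \<le> Suc 0" using panel_card [of y i] assms thick by simp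
  then have "\<not> {z \<in> \<Omega>. \<delta> y z = s i} \<subseteq> {x}"
    using card_mono [of "{x}" "{z \<in> \<Omega>. \<delta> y z = s i}"] by auto
  then obtain z where z: "z \<in> \<Omega>" "\<delta> y z = s i" "z \<noteq> x" by blast
  have "\<delta> x y = s i" using assms dist_sym by blast
  then have "\<delta> x z = s i \<or> \<delta> x z = \<one>"
    using dist_step [of x y z i] assms z by (auto simp: s_square)
  then show ?thesis using that z dist_one assms by blast
qed

text \<open>A word for \<open>w\<close> is walked from \<open>x\<close> with
  \<open>dist_reach\<close>, starting with its last letter.\<close>

lemma sphere_nonempty:
  assumes "x \<in> \<Omega>" "w \<in> carrier W"
  obtains y where "y \<in> \<Omega>" "\<delta> x y = w"
proof -
  have "\<exists>y\<in>\<Omega>. \<delta> x y = word ws" if "set ws \<subseteq> I" for ws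
    using that
  proof (induction ws)
    case Nil then show ?case using assms dist_one by auto
  next
    case (Cons i js)
    then obtain y where y: "y \<in> \<Omega>" "\<delta> x y = word js" by auto
    with Cons.prems dist_reach [of x y i] assms show ?case by auto
  qed
  moreover obtain ws where "set ws \<subseteq> I" "word ws = w"
    using len_word [of w I] assms(2) para_I by blast
  ultimately show ?thesis using that by blast
qed

lemma finite_W: "finite (carrier W)"
proof -
  obtain x where "x \<in> \<Omega>" using chambers_nonempty by blast
  then have "carrier W \<subseteq> \<delta> x ` \<Omega>" using sphere_nonempty by blast
  then show ?thesis using finite_chambers finite_surj by blast
qed

text \<open>Stated with \<open>\<le>\<close>, because the strict increase ws only known afterwards.\<close>

lemma dist_ascend_weak:
  assumes "x \<in> \<Omega>" "y \<in> \<Omega>" "z \<in> \<Omega>" "i \<in> I" "\<delta> y z = s i" "ell (\<delta> x y) \<le> ell (s i \<otimes> \<delta> x y)"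
  shows "\<delta> x z = s i \<otimes> \<delta> x y"
  using assms
proof (induction "ell (\<delta> x y)" arbitrary: x)
  case 0
  then have "\<delta> x y = \<one>" using len_eq_0 para_I by simp
  with 0 show ?case using dist_one by auto
next
  case (Suc k)
  let ?w = "\<delta> x y"
  have w: "?w \<in> carrier W" using Suc.prems by simp
  have "?w \<noteq> \<one>" using Suc.hyps(2) by auto
  then obtain j u where j: "j \<in> I" "u \<in> carrier W" "?w = u \<otimes> s j" "ell ?w = Suc (ell u)"
    using len_split_right w by blast
  obtain x' where x': "x' \<in> \<Omega>" "\<delta> x x' = s j" "\<delta> x' y = ?w \<otimes> s j"
    using dist_reach_left Suc.prems j by blast
  have wt: "?w \<otimes> s j = u" using j by (simp add: m_assoc s_square)
  \<comment> \<open>Were \<open>z\<close> still at distance \<open>?w\<close> from \<open>x\<close>,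
    then from \<open>x'\<close> it would be at distance \<open>s i \<otimes> u\<close> by induction,
    and at \<open>?w\<close> or \<open>u\<close> by the single step from \<open>x\<close>. Only
    \<open>s i \<otimes> u = ?w\<close> remains, which makes \<open>s i \<otimes> ?w = u\<close>
    shorter than \<open>?w\<close>.\<close>
  show ?case
  proof (rule ccontr)
    assume "\<delta> x z \<noteq> s i \<otimes> ?w"
    then have xz: "\<delta> x z = ?w" using dist_step Suc.prems by blast
    have "s i \<otimes> ?w = (s i \<otimes> u) \<otimes> s j" using j Suc.prems(4) by (simp add: m_assoc)
    then have "ell (s i \<otimes> ?w) \<le> Suc (ell (s i \<otimes> u))"
      using len_mult_s_le j Suc.prems(4) by simp
    then have "ell u \<le> ell (s i \<otimes> u)" using Suc.prems(6) j(4) by linarith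
    then have su: "\<delta> x' z = s i \<otimes> u"
      using Suc.hyps(1) [of x'] Suc.prems x' wt j(4) Suc.hyps(2) by simp
    have "\<delta> x' z = ?w \<or> \<delta> x' z = u"
      using dist_step_left [of x x' z j] Suc.prems x' j(1) xz wt by simp
    then have "s i \<otimes> u = ?w" using su s_mult_ne j Suc.prems(4) by metis
    then have "s i \<otimes> ?w = u" using j Suc.prems(4) by (metis s_cancel)
    then show False using Suc.prems(6) j(4) by simp
  qed
qed

text \<open>With equal lengths, the steps from \<open>y\<close> and from \<open>z\<close> to a third
  chamber \<open>z'\<close> of their panel would both be weak ascents, so \<open>z'\<close> would be
  at distance \<open>s i \<otimes> w\<close> and also at distance \<open>w\<close> from
  \<open>x\<close>.\<close>

lemma ell_s_ne:
  assumes "i \<in> I" "w \<in> carrier W"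
  shows "ell (s i \<otimes> w) \<noteq> ell w"
proof
  assume eq: "ell (s i \<otimes> w) = ell w"
  obtain x where x: "x \<in> \<Omega>" using chambers_nonempty by blast
  obtain y where y: "y \<in> \<Omega>" "\<delta> x y = w" using sphere_nonempty x assms by blast
  obtain z where z: "z \<in> \<Omega>" "\<delta> y z = s i" "\<delta> x z = s i \<otimes> w"
    using dist_reach x y assms by blast
  obtain z' where z': "z' \<in> \<Omega>" "\<delta> y z' = s i" "\<delta> z z' = s i"
    using other_neighbour [of z y i] z y assms by blast
  have "\<delta> x z' = s i \<otimes> w" using dist_ascend_weak [of x y z' i] x y z' assms eq by simp
  moreover have "\<delta> x z' = w" using dist_ascend_weak [of x z z' i] x z z' assms eq by simp
  ultimately show False using s_mult_ne assms by simp
qed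

lemma ell_s_cases:
  assumes "i \<in> I" "w \<in> carrier W"
  obtains "ell (s i \<otimes> w) = Suc (ell w)" | "ell w = Suc (ell (s i \<otimes> w))"
proof -
  have "w \<in> para I" using assms para_I by simp
  then have "ell (s i \<otimes> w) \<le> Suc (ell w)" "ell w \<le> Suc (ell (s i \<otimes> w))"
    using len_s_le len_s_ge assms(1) by auto
  then show ?thesis using ell_s_ne [OF assms] that by linarith
qed

lemma dist_ascend:
  assumes "x \<in> \<Omega>" "y \<in> \<Omega>" "z \<in> \<Omega>" "i \<in> I" "\<delta> y z = s i" "ell (\<delta> x y) < ell (s i \<otimes> \<delta> x y)"
  shows "\<delta> x z = s i \<otimes> \<delta> x y"
  using assms by (intro dist_ascend_weak) auto

text \<open>The folding condition of Coxeter groups. Because \<open>s i\<close> shortens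
  \<open>u \<otimes> s j\<close>, two chambers \<open>y\<close> and \<open>z\<close> of one panel
  lie at that distance from \<open>x\<close>. A \<open>j\<close>-neighbour \<open>x'\<close> of
  \<open>x\<close> sees \<open>y\<close> at distance \<open>u\<close>, hence \<open>z\<close> at
  distance \<open>s i \<otimes> u\<close>, but it can see \<open>z\<close> only at
  \<open>u \<otimes> s j\<close> or at \<open>u\<close>.\<close>

lemma folding:
  assumes "i \<in> I" "j \<in> I" "u \<in> carrier W"
    and up: "ell u < ell (s i \<otimes> u)" and down: "ell (s i \<otimes> (u \<otimes> s j)) < ell (u \<otimes> s j)"
  shows "s i \<otimes> u = u \<otimes> s j"
proof -
  let ?w = "u \<otimes> s j"
  have w: "?w \<in> carrier W" using assms by simp
  obtain x where x: "x \<in> \<Omega>" using chambers_nonempty by blast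
  obtain y where y: "y \<in> \<Omega>" "\<delta> x y = ?w" using sphere_nonempty x w by blast
  obtain y' where y': "y' \<in> \<Omega>" "\<delta> y y' = s i" "\<delta> x y' = s i \<otimes> ?w"
    using dist_reach x y assms(1) by metis
  obtain z where z: "z \<in> \<Omega>" "\<delta> y' z = s i" "\<delta> y z = s i"
    using other_neighbour [of y y' i] y y' assms(1) dist_sym by blast
  have xz: "\<delta> x z = ?w"
    using dist_ascend [of x y' z i] x y' z assms(1) w down by simp
  obtain x' where x': "x' \<in> \<Omega>" "\<delta> x x' = s j" "\<delta> x' y = ?w \<otimes> s j"
    using dist_reach_left [of x y j] x y assms(2) by metis
  have wt: "?w \<otimes> s j = u" using assms by (simp add: m_assoc s_square)
  have "\<delta> x' z = s i \<otimes> u"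
    using dist_ascend [of x' y z i] x' y z assms(1) wt up by simp
  moreover have "\<delta> x' z = ?w \<or> \<delta> x' z = u"
    using dist_step_left [of x x' z j] x x' z assms(2) xz wt by simp
  ultimately show ?thesis using s_mult_ne assms by metis
qed

text \<open>Two different candidates would be \<open>i\<close>-adjacent to each other, and the
  ascent from one of them would put the other at distance \<open>s i \<otimes> u\<close>.\<close>

lemma unique_descent:
  assumes "x \<in> \<Omega>" "z \<in> \<Omega>" "i \<in> I" "u \<in> carrier W" "ell u < ell (s i \<otimes> u)"
    and "y \<in> \<Omega>" "\<delta> y z = s i" "\<delta> x y = u" and "y' \<in> \<Omega>" "\<delta> y' z = s i" "\<delta> x y' = u"
  shows "y = y'"
proof (rule ccontr)
  assume ne: "y \<noteq> y'"
  have zy': "\<delta> z y' = s i" using assms dist_sym by blast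
  then have "\<delta> y y' = s i \<or> \<delta> y y' = \<one>"
    using dist_step [of y z y' i] assms by (auto simp: s_square)
  then have "\<delta> y y' = s i" using ne dist_one assms by blast
  then have "\<delta> x y' = s i \<otimes> u" using dist_ascend [of x y y' i] assms by simp
  then show False using assms s_mult_ne by metis
qed

lemma ex1_descent:
  assumes "x \<in> \<Omega>" "z \<in> \<Omega>" "i \<in> I" "u \<in> carrier W" "ell u < ell (s i \<otimes> u)" "\<delta> x z = s i \<otimes> u"
  shows "\<exists>!y. y \<in> \<Omega> \<and> \<delta> y z = s i \<and> \<delta> x y = u"
proof -
  obtain y where "y \<in> \<Omega>" "\<delta> z y = s i" "\<delta> x y = s i \<otimes> \<delta> x z"
    using dist_reach [of x z i] assms by blast
  then have "y \<in> \<Omega> \<and> \<delta> y z = s i \<and> \<delta> x y = u"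
    using assms dist_sym [of z y i] by simp
  then show ?thesis using unique_descent assms by blast
qed

text \<open>By the unique predecessor in \<open>ex1_descent\<close>, the sphere of
  \<open>s i \<otimes> u\<close> is fibred over the sphere of \<open>u\<close> with fibres of size
  \<open>q\<close>.\<close>

lemma sphere_card:
  assumes "x \<in> \<Omega>" "w \<in> carrier W"
  shows "card {y \<in> \<Omega>. \<delta> x y = w} = q ^ ell w"
  using assms(2)
proof (induction "ell w" arbitrary: w)
  case 0
  then have "w = \<one>" using len_eq_0 para_I by simp
  then have "{y \<in> \<Omega>. \<delta> x y = w} = {x}" using dist_one assms(1) by auto
  then show ?case using 0 by simp
next
  case (Suc k)
  then have "w \<noteq> \<one>" by auto
  then obtain i u where i: "i \<in> I" "u \<in> carrier W" "w = s i \<otimes> u" "ell w = Suc (ell u)"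
    using len_split_left [of I w] Suc.prems para_I by auto
  let ?S = "\<lambda>v. {y \<in> \<Omega>. \<delta> x y = v}" and ?P = "\<lambda>y. {z \<in> \<Omega>. \<delta> y z = s i}"
  have up: "ell u < ell (s i \<otimes> u)" using i by simp
  have "?S w = (\<Union>y\<in>?S u. ?P y)"
  proof (intro equalityI subsetI)
    fix z assume "z \<in> ?S w"
    then show "z \<in> (\<Union>y\<in>?S u. ?P y)"
      using ex1_descent [of x z i u] up i assms(1) by auto
  next
    fix z assume "z \<in> (\<Union>y\<in>?S u. ?P y)"
    then obtain y where "y \<in> \<Omega>" "\<delta> x y = u" "z \<in> \<Omega>" "\<delta> y z = s i" by blast
    then show "z \<in> ?S w" using dist_ascend [of x y z i] up i assms(1) by simp
  qed
  also have "card \<dots> = (\<Sum>y\<in>?S u. card (?P y))"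
    using finite_chambers unique_descent [OF assms(1) _ i(1,2) up]
    by (intro card_UN_disjoint) auto
  also have "\<dots> = (\<Sum>y\<in>?S u. q)" using panel_card i(1) by (intro sum.cong) auto
  also have "\<dots> = q ^ ell w" using Suc.hyps(1) [of u] i Suc.hyps(2) by simp
  finally show ?case .
qed

section \<open>Left descents, deletion and minimal representatives of parabolic cosets\<close>

definition descent_set :: "'w \<Rightarrow> 'i set" where
  "descent_set w = {i \<in> I. ell (s i \<otimes> w) < ell w}"

lemma descent_set_iff: "i \<in> I \<Longrightarrow> w \<in> carrier W \<Longrightarrow> i \<notin> descent_set w \<longleftrightarrow> ell w < ell (s i \<otimes> w)"
  using ell_s_ne [of i w] by (auto simp: descent_set_def)

text \<open>Either \<open>s i\<close> already shortens the prefix before the last letter, or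
  \<open>folding\<close> moves \<open>s i\<close> across that prefix, where it becomes the last
  letter and cancels it. The letters of the new word come from the old one, which is what
  \<open>ell_para\<close> needs.\<close>

lemma deletion:
  assumes "i \<in> I" "set ws \<subseteq> I" "ell (s i \<otimes> word ws) < ell (word ws)"
  shows "\<exists>js. set js \<subseteq> set ws \<and> length js < length ws \<and> word js = s i \<otimes> word ws"
  using assms(2,3)
proof (induction ws rule: rev_induct)
  case Nil
  then show ?case by simp
next
  case (snoc j ws)
  then have j: "j \<in> I" and ws: "set ws \<subseteq> I" and w: "word (ws @ [j]) = word ws \<otimes> s j"
    by (auto simp: word_append)
  show ?case
  proof (cases "ell (s i \<otimes> word ws) < ell (word ws)")
    case True
    then obtain js where "set js \<subseteq> set ws" "length js < length ws" "word js = s i \<otimes> word ws"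
      using snoc.IH ws by blast
    then show ?thesis using ws j assms(1)
      by (intro exI [of _ "js @ [j]"]) (auto simp: word_append m_assoc)
  next
    case False
    then have "s i \<otimes> word ws = word ws \<otimes> s j"
      using folding [of i j "word ws"] ell_s_ne [of i "word ws"] assms(1) j ws snoc.prems w
      by simp
    then have "s i \<otimes> word (ws @ [j]) = word ws"
      using w j ws assms(1) by (simp add: m_assoc [symmetric]) (simp add: m_assoc s_square)
    then show ?thesis by (intro exI [of _ ws]) auto
  qed
qed

text \<open>If \<open>s i\<close> shortened \<open>v\<close> in \<open>W\<close>,
  \<open>deletion\<close> would spell \<open>s i \<otimes> v\<close> by a word over \<open>J\<close>
  shorter than \<open>len J v\<close>; so both lengths grow by one at each letter.\<close>

lemma ell_para:
  assumes "J \<subseteq> I" "u \<in> para J"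
  shows "ell u = len J u"
  using assms(2)
proof (induction "len J u" arbitrary: u)
  case 0
  then show ?case using len_eq_0 by simp
next
  case (Suc k)
  then have "u \<noteq> \<one>" by auto
  then obtain i v where i: "i \<in> J" "v \<in> para J" "u = s i \<otimes> v" "len J u = Suc (len J v)"
    using len_split_left [OF assms(1) Suc.prems] by blast
  have iI: "i \<in> I" "v \<in> carrier W" using i assms(1) para_closed by auto
  have IH: "ell v = len J v" using Suc i by simp
  have "\<not> ell (s i \<otimes> v) < ell v"
  proof
    assume down: "ell (s i \<otimes> v) < ell v"
    obtain ws where ws: "set ws \<subseteq> J" "word ws = v" "length ws = len J v"
      using i(2) by (rule len_word)
    then obtain js where "set js \<subseteq> set ws" "length js < length ws" "word js = s i \<otimes> v"
      using deletion [of i ws] down iI assms(1) by auto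
    then show False using len_le [of js J] ws i by force
  qed
  then show ?case by - (rule ell_s_cases [OF iI], use IH i in auto)
qed

text \<open>Induction on \<open>ell x\<close>, and within it on the length of \<open>u\<close>. If a
  letter of \<open>u\<close> failed to lengthen the product, \<open>folding\<close> would yield an
  element of \<open>para J\<close> that carries the shorter \<open>y\<close> to
  \<open>x\<close>.\<close>

lemma ell_mult_minimal:
  assumes "J \<subseteq> I" "x \<in> carrier W" "descent_set x \<inter> J = {}" "u \<in> para J"
  shows "ell (u \<otimes> x) = len J u + ell x"
  using assms(2-)
proof (induction "ell x" arbitrary: x u rule: less_induct)
  case (less x)
  have up: "ell x < ell (s i \<otimes> x)" if "i \<in> J" for i
    using that less.prems descent_set_iff assms(1) by blast
  show ?case
  proof (cases "x = \<one>")
    case True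
    then show ?thesis using ell_para less.prems assms(1) para_closed by simp
  next
    case False
    then obtain j y where j: "j \<in> I" "y \<in> carrier W" "x = y \<otimes> s j" "ell x = Suc (ell y)"
      using len_split_right less.prems by blast
    \<comment> \<open>A descent of \<open>y\<close> in \<open>J\<close> would be one of
      \<open>x = y \<otimes> s j\<close> too, because right multiplication by \<open>s j\<close>
      adds at most one to the length.\<close>
    have "descent_set y \<inter> J = {}"
    proof (rule ccontr)
      assume "descent_set y \<inter> J \<noteq> {}"
      then obtain i where i: "i \<in> J" "i \<in> I" "ell (s i \<otimes> y) < ell y"
        using assms(1) by (auto simp: descent_set_def)
      have "ell (s i \<otimes> x) \<le> Suc (ell (s i \<otimes> y))"
        using len_mult_s_le [of j "s i \<otimes> y"] i j by (simp add: m_assoc)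
      then show False using i j up [of i] by simp
    qed
    then have IH: "ell (v \<otimes> y) = len J v + ell y" if "v \<in> para J" for v
      using less.hyps [of y v] j that by simp
    show ?thesis using less.prems(3)
    proof (induction "len J u" arbitrary: u)
      case 0
      then show ?case using len_eq_0 less.prems by simp
    next
      case (Suc k)
      then have "u \<noteq> \<one>" by auto
      then obtain i v where i: "i \<in> J" "v \<in> para J" "u = s i \<otimes> v" "len J u = Suc (len J v)"
        using len_split_left [OF assms(1) Suc.prems] by blast
      have iI: "i \<in> I" and vc: "v \<in> carrier W" using i assms(1) para_closed by auto
      have vx: "ell (v \<otimes> x) = len J v + ell x" using Suc i by simp
      have eqs: "u \<otimes> x = s i \<otimes> (v \<otimes> x)" "v \<otimes> x = (v \<otimes> y) \<otimes> s j" "u \<otimes> y = s i \<otimes> (v \<otimes> y)"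
        using iI vc i j by (simp_all add: m_assoc)
      have "\<not> ell (u \<otimes> x) < ell (v \<otimes> x)"
      proof
        assume "ell (u \<otimes> x) < ell (v \<otimes> x)"
        moreover have "ell (v \<otimes> y) < ell (s i \<otimes> (v \<otimes> y))"
          using IH [OF i(2)] IH [OF Suc.prems] i(4) eqs(3) by simp
        ultimately have fold: "s i \<otimes> (v \<otimes> y) = (v \<otimes> y) \<otimes> s j"
          using folding [of i j "v \<otimes> y"] iI j vc eqs by simp
        \<comment> \<open>The folding identity says \<open>t \<otimes> y = x\<close> for this
          conjugate of \<open>s i\<close> in \<open>para J\<close>. The induction hypothesis for
          \<open>y\<close> gives \<open>t\<close> length 1, so \<open>t\<close> is a generator from
          \<open>J\<close> that shortens \<open>x\<close>, against the assumption on the descents of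
          \<open>x\<close>.\<close>
        define t where "t = inv v \<otimes> (s i \<otimes> v)"
        have t: "t \<in> para J"
          unfolding t_def using para_mult para_inv s_in_para i assms(1) by simp
        have tc: "t \<in> carrier W" using t assms(1) para_closed by blast
        have "t \<otimes> y = inv v \<otimes> (s i \<otimes> (v \<otimes> y))"
          unfolding t_def using vc iI j by (simp add: m_assoc)
        also have "\<dots> = inv v \<otimes> (v \<otimes> (y \<otimes> s j))" using fold vc j by (simp add: m_assoc)
        also have "\<dots> = x" using vc j by (simp add: m_assoc [symmetric])
        finally have ty: "t \<otimes> y = x" .
        then have lt: "len J t = 1" using IH [OF t] j(4) by simp
        then have "t \<noteq> \<one>" by auto
        then obtain i' v' where i': "i' \<in> J" "v' \<in> para J" "t = s i' \<otimes> v'" "len J t = Suc (len J v')"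
          using len_split_left [OF assms(1) t] by blast
        then have "t = s i'" using lt len_eq_0 [OF i'(2)] assms(1) by auto
        then have "s i' \<otimes> x = y"
          using ty s_cancel [of i' y] i'(1) j(2) assms(1) by (metis subsetD)
        then show False using up [OF i'(1)] j(4) by simp
      qed
      then show ?case
        using ell_s_cases [of i "v \<otimes> x"] iI vc less.prems(1) vx i(4) eqs(1)
        by (metis add_Suc lessI m_closed)
    qed
  qed
qed

text \<open>Length is additive from \<open>x\<close> to \<open>u \<otimes> x\<close> and from there
  back by \<open>inv u\<close>, so \<open>u\<close> has length 0.\<close>

lemma minimal_unique:
  assumes "J \<subseteq> I" "x \<in> carrier W" "descent_set x \<inter> J = {}" "descent_set (u \<otimes> x) \<inter> J = {}" "u \<in> para J"
  shows "u = \<one>"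
proof -
  have uc: "u \<in> carrier W" using assms para_closed by blast
  have "ell (u \<otimes> x) = len J u + ell x" using ell_mult_minimal assms by blast
  moreover have "ell (inv u \<otimes> (u \<otimes> x)) = len J (inv u) + ell (u \<otimes> x)"
    using assms uc para_inv by (intro ell_mult_minimal) auto
  ultimately have "len J u = 0" using uc assms(2) by (simp add: m_assoc [symmetric])
  then show ?thesis using len_eq_0 assms by blast
qed

end

section \<open>The 0-Hecke operators\<close>

text \<open>The vanishing of \<open>q\<close> in the field specialises the operators below to those
  of the 0-Hecke algebra.\<close>

locale hecke_building = building W I s \<Omega> \<delta> q
  for W :: "('w, 'm) monoid_scheme" (structure) and I :: "'i set" and s :: "'i \<Rightarrow> 'w"
    and \<Omega> :: "'c set" and \<delta> :: "'c \<Rightarrow> 'c \<Rightarrow> 'w" and q :: nat +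
  fixes scalars :: "'f::field itself"
  assumes q_eq_0: "of_nat q = (0::'f)"
begin

definition space :: "('c \<Rightarrow> 'f) set" where
  "space = {v. \<forall>x. x \<notin> \<Omega> \<longrightarrow> v x = 0}"

text \<open>In terms of basis vectors, \<open>T w\<close> sends the indicator of a chamber
  \<open>y\<close> to the sum of the indicators of all \<open>z\<close> with
  \<open>\<delta> y z = w\<close>.\<close>

definition T :: "'w \<Rightarrow> ('c \<Rightarrow> 'f) \<Rightarrow> 'c \<Rightarrow> 'f" where
  "T w v = (\<lambda>z. if z \<in> \<Omega> then \<Sum>y | y \<in> \<Omega> \<and> \<delta> y z = w. v y else 0)"

lemma space_eqI: "u \<in> space \<Longrightarrow> v \<in> space \<Longrightarrow> (\<And>z. z \<in> \<Omega> \<Longrightarrow> u z = v z) \<Longrightarrow> u = v"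
  by (force simp: space_def)

lemma T_in_space [simp]: "T w v \<in> space"
  by (simp add: T_def space_def)

lemma T_add: "T w (u + v) = T w u + T w v"
  by (rule ext) (simp add: T_def sum.distrib)

lemma T_scale: "T w (\<lambda>x. c * v x) = (\<lambda>x. c * T w v x)"
  by (rule ext) (simp add: T_def sum_distrib_left)

lemma T_one: "v \<in> space \<Longrightarrow> T \<one> v = v"
proof (rule space_eqI)
  fix z assume "z \<in> \<Omega>"
  then have "{y. y \<in> \<Omega> \<and> \<delta> y z = \<one>} = {z}" using dist_one by auto
  then show "T \<one> v z = v z" using \<open>z \<in> \<Omega>\<close> by (simp add: T_def)
qed auto

text \<open>Each chamber contributing to \<open>T (s i \<otimes> w)\<close> at \<open>z\<close>
  passes through exactly one intermediate \<open>y\<close>, so the double sum has no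
  repetitions.\<close>

lemma T_ascend:
  assumes "i \<in> I" "w \<in> carrier W" "ell w < ell (s i \<otimes> w)"
  shows "T (s i) (T w v) = T (s i \<otimes> w) v"
proof (rule space_eqI)
  fix z assume z: "z \<in> \<Omega>"
  let ?Y = "{y. y \<in> \<Omega> \<and> \<delta> y z = s i}" and ?X = "\<lambda>w y. {x. x \<in> \<Omega> \<and> \<delta> x y = w}"
  have eq: "(\<Union>y\<in>?Y. ?X w y) = ?X (s i \<otimes> w) z"
  proof (intro equalityI subsetI)
    fix x assume "x \<in> (\<Union>y\<in>?Y. ?X w y)"
    then obtain y where "y \<in> \<Omega>" "\<delta> y z = s i" "x \<in> \<Omega>" "\<delta> x y = w" by blast
    then show "x \<in> ?X (s i \<otimes> w) z" using dist_ascend [of x y z i] z assms by simp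
  next
    fix x assume "x \<in> ?X (s i \<otimes> w) z"
    then show "x \<in> (\<Union>y\<in>?Y. ?X w y)" using ex1_descent [of x z i w] z assms by blast
  qed
  have "T (s i) (T w v) z = (\<Sum>y\<in>?Y. \<Sum>x\<in>?X w y. v x)"
    using z by (auto simp: T_def intro!: sum.cong)
  also have "\<dots> = (\<Sum>x\<in>(\<Union>y\<in>?Y. ?X w y). v x)"
    using finite_chambers unique_descent [OF _ z assms(1-3)]
    by (intro sum.UNION_disjoint [symmetric]) auto
  also have "\<dots> = T (s i \<otimes> w) v z" using z by (simp add: eq T_def)
  finally show "T (s i) (T w v) z = T (s i \<otimes> w) v z" .
qed auto

section \<open>Residues and the operators that sum over them\<close>

definition adjacent :: "'i set \<Rightarrow> ('c \<times> 'c) set" where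
  "adjacent J = {(x, y) \<in> \<Omega> \<times> \<Omega>. \<delta> x y \<in> para J}"

text \<open>Each letter of \<open>\<delta> y z\<close> either multiplies the distance from
  \<open>x\<close> or leaves it alone, so the accumulated left factor stays in
  \<open>para J\<close>. This gives transitivity of \<open>adjacent J\<close>.\<close>

lemma dist_word:
  assumes "x \<in> \<Omega>" "y \<in> \<Omega>" "z \<in> \<Omega>" "J \<subseteq> I" "\<delta> y z \<in> para J"
  shows "\<exists>v\<in>para J. \<delta> x z = v \<otimes> \<delta> x y"
  using assms
proof (induction "len J (\<delta> y z)" arbitrary: z)
  case 0
  then have "y = z" using len_eq_0 dist_one by simp
  then show ?case using 0 by (intro bexI [of _ \<one>]) auto
next
  case (Suc k)
  then have "\<delta> y z \<noteq> \<one>" by auto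
  then obtain i u where i: "i \<in> J" "u \<in> para J" "\<delta> y z = s i \<otimes> u" "len J (\<delta> y z) = Suc (len J u)"
    using len_split_left [OF Suc.prems(4,5)] by blast
  have iI: "i \<in> I" "u \<in> carrier W" using i Suc.prems para_closed by auto
  obtain z' where z': "z' \<in> \<Omega>" "\<delta> z z' = s i" "\<delta> y z' = s i \<otimes> \<delta> y z"
    using dist_reach [of y z i] Suc.prems iI by blast
  have u: "\<delta> y z' = u" using z' i iI by simp
  then obtain v where v: "v \<in> para J" "\<delta> x z' = v \<otimes> \<delta> x y"
    using Suc.hyps(1) [of z'] Suc.hyps(2) Suc.prems z' i by auto
  have vc: "v \<in> carrier W" using v Suc.prems para_closed by blast
  have "\<delta> x z = \<delta> x z' \<or> \<delta> x z = s i \<otimes> \<delta> x z'"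
    using dist_step [of x z' z i] dist_sym [of z z' i] z' Suc.prems iI by blast
  then show ?case
  proof
    assume "\<delta> x z = s i \<otimes> \<delta> x z'"
    then show ?case using v vc iI i Suc.prems para_mult [of J "s i" v] s_in_para [of J i]
      by (intro bexI [of _ "s i \<otimes> v"]) (auto simp: m_assoc)
  qed (use v in auto)
qed

lemma equiv_adjacent:
  assumes "J \<subseteq> I"
  shows "equiv \<Omega> (adjacent J)"
proof (rule equivI)
  show "adjacent J \<subseteq> \<Omega> \<times> \<Omega>" by (auto simp: adjacent_def)
  show "refl_on \<Omega> (adjacent J)"
  proof (rule refl_onI)
    fix x assume "x \<in> \<Omega>"
    then have "\<delta> x x = \<one>" using dist_one by blast
    then show "(x, x) \<in> adjacent J" using \<open>x \<in> \<Omega>\<close> by (simp add: adjacent_def)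
  qed
  show "sym (adjacent J)"
  proof (rule symI)
    fix x y assume "(x, y) \<in> adjacent J"
    then show "(y, x) \<in> adjacent J"
      using dist_inv [of x y] para_inv [OF assms] by (simp add: adjacent_def)
  qed
  show "trans (adjacent J)"
  proof (rule transI)
    fix x y z assume "(x, y) \<in> adjacent J" "(y, z) \<in> adjacent J"
    then show "(x, z) \<in> adjacent J"
      using dist_word [of x y z J] para_mult assms by (force simp: adjacent_def)
  qed
qed

text \<open>A plain sum serves as an average, since every class has size 1 in the field by
  \<open>class_card_eq_1\<close>.\<close>

definition avg :: "'i set \<Rightarrow> ('c \<Rightarrow> 'f) \<Rightarrow> 'c \<Rightarrow> 'f" where
  "avg J v = (\<lambda>z. if z \<in> \<Omega> then \<Sum>y\<in>adjacent J `` {z}. v y else 0)"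

definition invariants :: "'i set \<Rightarrow> ('c \<Rightarrow> 'f) set" where
  "invariants J = {v \<in> space. \<forall>(x, y)\<in>adjacent J. v x = v y}"

lemma avg_in_space: "avg J v \<in> space"
  by (simp add: avg_def space_def)

lemma avg_in_invariants:
  assumes "J \<subseteq> I" shows "avg J v \<in> invariants J"
proof -
  have "avg J v x = avg J v y" if "(x, y) \<in> adjacent J" for x y
  proof -
    have "adjacent J `` {x} = adjacent J `` {y}"
      using equiv_class_eq [OF equiv_adjacent [OF assms] that] .
    then show ?thesis using that by (simp add: avg_def adjacent_def)
  qed
  then show ?thesis by (auto simp: invariants_def avg_in_space)
qed

text \<open>Only the identity of \<open>W\<^sub>J\<close> contributes a summand \<open>q\<^bsup>\<ell>(u)\<^esup>\<close> prime to \<open>p\<close>.\<close>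

lemma class_card_eq_1:
  assumes "J \<subseteq> I" "x \<in> \<Omega>"
  shows "of_nat (card (adjacent J `` {x})) = (1::'f)"
proof -
  have fin: "finite (para J)" using finite_W para_subset [OF assms(1)] finite_subset by blast
  have "adjacent J `` {x} = (\<Union>u\<in>para J. {y \<in> \<Omega>. \<delta> x y = u})"
    using assms by (auto simp: adjacent_def)
  then have "card (adjacent J `` {x}) = (\<Sum>u\<in>para J. card {y \<in> \<Omega>. \<delta> x y = u})"
    using finite_chambers fin by (simp only:) (intro card_UN_disjoint, auto)
  also have "\<dots> = (\<Sum>u\<in>para J. q ^ ell u)"
    using sphere_card assms para_closed by (intro sum.cong) auto
  finally have "of_nat (card (adjacent J `` {x})) = (\<Sum>u\<in>para J. (of_nat q :: 'f) ^ ell u)"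
    by simp
  also have "\<dots> = (\<Sum>u\<in>para J. if u = \<one> then 1 else 0)"
  proof (rule sum.cong [OF refl])
    fix u assume "u \<in> para J"
    then have "ell u = 0 \<longleftrightarrow> u = \<one>"
      using len_eq_0 [of u I] para_closed [OF assms(1), of u] by (simp add: para_I)
    then show "(of_nat q :: 'f) ^ ell u = (if u = \<one> then 1 else 0)"
      by (auto simp: q_eq_0)
  qed
  also have "\<dots> = 1" using fin by simp
  finally show ?thesis .
qed

lemma avg_invariant:
  assumes "J \<subseteq> I" "v \<in> invariants J"
  shows "avg J v = v"
proof (rule space_eqI)
  fix z assume z: "z \<in> \<Omega>"
  have "(\<Sum>y\<in>adjacent J `` {z}. v y) = (\<Sum>y\<in>adjacent J `` {z}. v z)"
    using assms(2) by (intro sum.cong) (auto simp: invariants_def)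
  then have "avg J v z = (\<Sum>y\<in>adjacent J `` {z}. v z)" using z by (simp add: avg_def)
  also have "\<dots> = v z" using class_card_eq_1 [OF assms(1) z] by simp
  finally show "avg J v z = v z" .
qed (use assms in \<open>auto simp: avg_in_space invariants_def\<close>)

lemma avg_add: "avg J (u + v) = avg J u + avg J v"
  by (rule ext) (simp add: avg_def sum.distrib)

lemma avg_scale: "avg J (\<lambda>x. c * v x) = (\<lambda>x. c * avg J v x)"
  by (rule ext) (simp add: avg_def sum_distrib_left)

text \<open>Sorting a class by distance shows that the projection is a sum of Hecke operators, hence
  preserves every submodule.\<close>

lemma avg_eq_sum_T:
  assumes "J \<subseteq> I"
  shows "avg J v = (\<lambda>z. \<Sum>u\<in>para J. T u v z)"
proof
  fix z
  have fin: "finite (para J)" using finite_W para_subset [OF assms(1)] finite_subset by blast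
  show "avg J v z = (\<Sum>u\<in>para J. T u v z)"
  proof (cases "z \<in> \<Omega>")
    case True
    \<comment> \<open>\<open>T\<close> selects \<open>y\<close> by \<open>\<delta> y z\<close>,
      while the class of \<open>z\<close> is read off from \<open>\<delta> z y\<close>; symmetry of
      adjacency connects the two.\<close>
    have "adjacent J `` {z} = (adjacent J)\<inverse> `` {z}"
      using equiv_adjacent [OF assms] unfolding equiv_def sym_conv_converse_eq by simp
    also have "\<dots> = (\<Union>u\<in>para J. {y. y \<in> \<Omega> \<and> \<delta> y z = u})"
      using True by (auto simp: adjacent_def)
    finally have "avg J v z = (\<Sum>y\<in>(\<Union>u\<in>para J. {y. y \<in> \<Omega> \<and> \<delta> y z = u}). v y)"
      using True by (simp add: avg_def)
    also have "\<dots> = (\<Sum>u\<in>para J. \<Sum>y | y \<in> \<Omega> \<and> \<delta> y z = u. v y)"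
      using finite_chambers fin by (intro sum.UNION_disjoint) auto
    finally show ?thesis using True by (simp add: T_def)
  qed (simp add: avg_def T_def)
qed

text \<open>The sum over a panel without \<open>z\<close> has \<open>q\<close> equal terms, and
  \<open>q\<close> is 0 in the field.\<close>

lemma T_invariant:
  assumes "J \<subseteq> I" "i \<in> J" "v \<in> invariants J"
  shows "T (s i) v = (\<lambda>_. 0)"
proof (rule space_eqI)
  fix z assume z: "z \<in> \<Omega>"
  have iI: "i \<in> I" using assms by blast
  have "{y. y \<in> \<Omega> \<and> \<delta> y z = s i} = {y \<in> \<Omega>. \<delta> z y = s i}"
    using dist_sym z iI by blast
  then have c: "card {y. y \<in> \<Omega> \<and> \<delta> y z = s i} = q" using panel_card [OF z iI] by simp
  have "(\<Sum>y | y \<in> \<Omega> \<and> \<delta> y z = s i. v y) = (\<Sum>y | y \<in> \<Omega> \<and> \<delta> y z = s i. v z)"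
    using z assms s_in_para [OF assms(1,2)]
    by (intro sum.cong) (auto simp: invariants_def adjacent_def)
  then have "T (s i) v z = (\<Sum>y | y \<in> \<Omega> \<and> \<delta> y z = s i. v z)" using z by (simp add: T_def)
  also have "\<dots> = 0" using c q_eq_0 by simp
  finally show "T (s i) v z = 0" .
qed (auto simp: space_def T_def)

lemma para_singleton:
  assumes "i \<in> I" shows "para {i} = {\<one>, s i}"
proof -
  have "word ws \<in> {\<one>, s i}" if "set ws \<subseteq> {i}" for ws
    using that assms by (induction ws) (auto simp: s_square)
  then show ?thesis using s_in_para [of "{i}" i] one_in_para assms by (auto simp: para_def)
qed

text \<open>The operator \<open>avg {i}\<close> is the identity plus \<open>T (s i)\<close>, and its
  values are invariants, which \<open>T (s i)\<close> kills.\<close>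

lemma T_T_s:
  assumes "i \<in> I"
  shows "T (s i) (T (s i) v) = (\<lambda>z. - T (s i) v z)"
proof -
  \<comment> \<open>\<open>T \<one>\<close> is the identity on functions supported on the chambers,
    and \<open>T w\<close> ignores values elsewhere, so \<open>v\<close> may be cut off.\<close>
  define v' where "v' = (\<lambda>z. if z \<in> \<Omega> then v z else 0)"
  have v': "v' \<in> space" "T w v = T w v'" for w
    by (auto simp: v'_def space_def T_def intro!: ext sum.cong)
  have "avg {i} v' = v' + T (s i) v'"
    using assms s_ne_one [OF assms] T_one [OF v'(1)]
    by (auto simp: avg_eq_sum_T para_singleton fun_eq_iff)
  then have "T (s i) (v' + T (s i) v') = (\<lambda>_. 0)"
    using T_invariant [of "{i}" i "avg {i} v'"] avg_in_invariants [of "{i}" v'] assms by simp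
  then have "T (s i) v' + T (s i) (T (s i) v') = (\<lambda>_. 0)" by (simp add: T_add)
  then have "T (s i) (T (s i) v') z = - T (s i) v' z" for z
    by (simp add: fun_eq_iff eq_neg_iff_add_eq_0 add.commute)
  then show ?thesis unfolding v'(2) by (rule ext)
qed

lemma T_descend:
  assumes "i \<in> I" "w \<in> carrier W" "ell (s i \<otimes> w) < ell w"
  shows "T (s i) (T w v) = (\<lambda>z. - T w v z)"
proof -
  have "T w v = T (s i) (T (s i \<otimes> w) v)"
    using T_ascend [of i "s i \<otimes> w" v] assms by simp
  then show ?thesis using T_T_s [OF assms(1)] by simp
qed

end

section \<open>Submodules and composition factors\<close>

interpretation fun_vs: vector_space "\<lambda>(c::'f::field) (v::'c \<Rightarrow> 'f) x. c * v x"
  by unfold_locales (auto simp: fun_eq_iff algebra_simps)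

declare fun_vs.scale_scale [simp del] \<comment> \<open>loops together with \<open>mult.assoc\<close>\<close>

lemma lin_subspace_iff: "lin_subspace U \<longleftrightarrow> fun_vs.subspace U"
  by (simp add: lin_subspace_def fun_vs.subspace_def zero_fun_def plus_fun_def)

lemma sum_fun_apply: "(\<Sum>a\<in>A. f a) x = (\<Sum>a\<in>A. f a x :: 'f::comm_monoid_add)"
  by (induction A rule: infinite_finite_induct) auto

text \<open>Inclusion-exclusion as an induction: the values on proper subsets already agree, so the
  sum over \<open>Pow D\<close> leaves only the value at \<open>D\<close>.\<close>

lemma eq_of_lower_sums_eq:
  fixes f g :: "'i set \<Rightarrow> nat"
  assumes "finite D" "\<And>D'. D' \<subseteq> D \<Longrightarrow> sum f (Pow D') = sum g (Pow D')"
  shows "f D = g D"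
  using assms
proof (induction D rule: finite_psubset_induct)
  case (psubset D)
  have fin: "finite (Pow D)" using psubset.hyps by simp
  have "sum f (Pow D - {D}) = sum g (Pow D - {D})"
    using psubset by (intro sum.cong) auto
  moreover have "sum f (Pow D) = f D + sum f (Pow D - {D})" "sum g (Pow D) = g D + sum g (Pow D - {D})"
    using fin by (simp_all add: sum.remove [of "Pow D" D])
  ultimately show ?case using psubset.prems [of D] by simp
qed

context hecke_building
begin

text \<open>\<open>stable\<close> and \<open>factor\<close> are the notions \<open>hsubmod\<close>
  and \<open>factor_iso_C\<close> in the language of chambers; \<open>hsubmod_eq\<close> and
  \<open>factor_iso_C_eq\<close> identify them.\<close>

definition stable :: "('c \<Rightarrow> 'f) set \<Rightarrow> bool" where
  "stable U \<longleftrightarrow> lin_subspace U \<and> U \<subseteq> space \<and> (\<forall>i\<in>I. \<forall>v\<in>U. T (s i) v \<in> U)"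

definition eigen_mod :: "('c \<Rightarrow> 'f) set \<Rightarrow> 'i set \<Rightarrow> ('c \<Rightarrow> 'f) \<Rightarrow> bool" where
  "eigen_mod U D v \<longleftrightarrow> (\<forall>i\<in>I. (\<lambda>z. T (s i) v z - (if i \<in> D then - 1 else 0) * v z) \<in> U)"

definition adjoin :: "('c \<Rightarrow> 'f) set \<Rightarrow> ('c \<Rightarrow> 'f) \<Rightarrow> ('c \<Rightarrow> 'f) set" where
  "adjoin U v = {(\<lambda>z. u z + c * v z) | u c. u \<in> U}"

definition factor :: "('c \<Rightarrow> 'f) set \<Rightarrow> ('c \<Rightarrow> 'f) set \<Rightarrow> 'i set \<Rightarrow> bool" where
  "factor U V D \<longleftrightarrow> (\<exists>v\<in>V. v \<notin> U \<and> V = adjoin U v) \<and> (\<forall>v\<in>V. eigen_mod U D v)"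

lemma subspace_space: "fun_vs.subspace space"
  by (auto simp: fun_vs.subspace_def space_def)

lemma stable_subspace: "stable U \<Longrightarrow> fun_vs.subspace U"
  by (simp add: stable_def lin_subspace_iff)

lemma stable_in_space: "stable U \<Longrightarrow> v \<in> U \<Longrightarrow> v \<in> space"
  by (auto simp: stable_def)

lemma stable_space: "stable space"
  by (simp add: stable_def lin_subspace_iff subspace_space)

lemma stable_zero: "stable {\<lambda>_. 0}"
  by (auto simp: stable_def lin_subspace_def space_def T_def)

lemma adjoinI: "u \<in> U \<Longrightarrow> (\<lambda>z. u z + c * v z) \<in> adjoin U v"
  by (auto simp: adjoin_def)

lemma adjoinE:
  assumes "x \<in> adjoin U v"
  obtains u c where "u \<in> U" "x = u + (\<lambda>z. c * v z)"
  using assms by (auto simp: adjoin_def plus_fun_def)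

lemma adjoin_add: "u \<in> U \<Longrightarrow> u + (\<lambda>z. c * v z) \<in> adjoin U v"
  using adjoinI by (simp add: plus_fun_def)

lemma adjoin_base: "u \<in> U \<Longrightarrow> u \<in> adjoin U v"
  using adjoinI [of u U 0 v] by simp

lemma adjoin_self:
  assumes "fun_vs.subspace U" shows "v \<in> adjoin U v"
  using adjoinI [of "\<lambda>_. 0" U 1 v] fun_vs.subspace_0 [OF assms] by (simp add: zero_fun_def)

lemma adjoin_subset:
  assumes "fun_vs.subspace V" "U \<subseteq> V" "v \<in> V"
  shows "adjoin U v \<subseteq> V"
  using assms by (auto elim!: adjoinE intro: fun_vs.subspace_add fun_vs.subspace_scale)

lemma eigen_modD:
  assumes "eigen_mod U D v" "i \<in> I"
  shows "i \<notin> D \<Longrightarrow> T (s i) v \<in> U" "i \<in> D \<Longrightarrow> T (s i) v + v \<in> U"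
  using assms by (auto simp: eigen_mod_def plus_fun_def dest!: bspec [of _ _ i])

lemma eigen_modI:
  assumes "\<And>i. i \<in> I \<Longrightarrow> i \<notin> D \<Longrightarrow> T (s i) v \<in> U" "\<And>i. i \<in> I \<Longrightarrow> i \<in> D \<Longrightarrow> T (s i) v + v \<in> U"
  shows "eigen_mod U D v"
  using assms by (auto simp: eigen_mod_def plus_fun_def)

lemma stable_adjoin:
  assumes U: "stable U" and v: "v \<in> space" "eigen_mod U D v"
  shows "stable (adjoin U v)"
proof -
  note sub = stable_subspace [OF U]
  have sp: "adjoin U v \<subseteq> space"
    using adjoin_subset [OF subspace_space _ v(1)] U by (simp add: stable_def)
  have "fun_vs.subspace (adjoin U v)"
  proof (rule fun_vs.subspaceI)
    show "0 \<in> adjoin U v" using adjoin_base fun_vs.subspace_0 [OF sub] by blast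
  next
    fix x y assume "x \<in> adjoin U v" "y \<in> adjoin U v"
    then obtain u c u' c' where "u \<in> U" "x = u + (\<lambda>z. c * v z)" "u' \<in> U" "y = u' + (\<lambda>z. c' * v z)"
      by (elim adjoinE)
    then have "u + u' \<in> U" and e: "x + y = (u + u') + (\<lambda>z. (c + c') * v z)"
      using fun_vs.subspace_add [OF sub] by (auto simp: fun_eq_iff algebra_simps)
    then show "x + y \<in> adjoin U v" unfolding e by (intro adjoin_add)
  next
    fix a x assume "x \<in> adjoin U v"
    then obtain u c where u: "u \<in> U" "x = u + (\<lambda>z. c * v z)" by (rule adjoinE)
    have e: "(\<lambda>z. a * x z) = (\<lambda>z. a * u z) + (\<lambda>z. (a * c) * v z)"
      by (simp add: u(2) fun_eq_iff distrib_left mult.assoc)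
    show "(\<lambda>z. a * x z) \<in> adjoin U v"
      unfolding e by (rule adjoin_add [OF fun_vs.subspace_scale [OF sub u(1)]])
  qed
  moreover have "T (s i) x \<in> adjoin U v" if i: "i \<in> I" and x: "x \<in> adjoin U v" for i x
  proof -
    obtain u c where u: "u \<in> U" "x = u + (\<lambda>z. c * v z)" using x by (rule adjoinE)
    have Tx: "T (s i) x = T (s i) u + (\<lambda>z. c * T (s i) v z)" by (simp add: u T_add T_scale)
    have Tu: "T (s i) u \<in> U" using U u i by (simp add: stable_def)
    show ?thesis
    proof (cases "i \<in> D")
      case True
      have e: "T (s i) x = (T (s i) u + (\<lambda>z. c * (T (s i) v + v) z)) + (\<lambda>z. (- c) * v z)"
        by (simp add: Tx fun_eq_iff distrib_left)
      show ?thesis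
        unfolding e
        by (intro adjoin_add fun_vs.subspace_add [OF sub Tu]
            fun_vs.subspace_scale [OF sub eigen_modD(2) [OF v(2) i True]])
    next
      case False
      have "T (s i) x \<in> U"
        unfolding Tx
        by (intro fun_vs.subspace_add [OF sub Tu]
            fun_vs.subspace_scale [OF sub eigen_modD(1) [OF v(2) i False]])
      then show ?thesis by (rule adjoin_base)
    qed
  qed
  ultimately show ?thesis using sp by (simp add: stable_def lin_subspace_iff)
qed

lemma factor_adjoin:
  assumes U: "stable U" and v: "v \<notin> U" "eigen_mod U D v"
  shows "factor U (adjoin U v) D"
proof -
  note sub = stable_subspace [OF U]
  have "eigen_mod U D x" if x: "x \<in> adjoin U v" for x
  proof -
    obtain u c where u: "u \<in> U" "x = u + (\<lambda>z. c * v z)" using x by (rule adjoinE)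
    have Tx: "T (s i) x = T (s i) u + (\<lambda>z. c * T (s i) v z)" for i by (simp add: u T_add T_scale)
    have Tu: "T (s i) u \<in> U" if "i \<in> I" for i using U u that by (simp add: stable_def)
    show ?thesis
    proof (rule eigen_modI)
      fix i assume i: "i \<in> I" "i \<notin> D"
      show "T (s i) x \<in> U"
        unfolding Tx
        by (intro fun_vs.subspace_add [OF sub Tu [OF i(1)]]
            fun_vs.subspace_scale [OF sub eigen_modD(1) [OF v(2) i]])
    next
      fix i assume i: "i \<in> I" "i \<in> D"
      have e: "T (s i) x + x = (T (s i) u + u) + (\<lambda>z. c * (T (s i) v + v) z)"
        by (simp add: Tx) (simp add: u fun_eq_iff distrib_left)
      show "T (s i) x + x \<in> U"
        unfolding e
        by (intro fun_vs.subspace_add [OF sub fun_vs.subspace_add [OF sub Tu [OF i(1)] u(1)]]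
            fun_vs.subspace_scale [OF sub eigen_modD(2) [OF v(2) i]])
    qed
  qed
  then show ?thesis using v(1) adjoin_self [OF sub] by (auto simp: factor_def)
qed

lemma T_stable:
  assumes "stable U" "v \<in> U" "w \<in> carrier W"
  shows "T w v \<in> U"
  using assms(3)
proof (induction "ell w" arbitrary: w)
  case 0
  then have "w = \<one>" using len_eq_0 [of w I] para_I by simp
  then show ?case using assms(1,2) T_one [of v] by (auto simp: stable_def)
next
  case (Suc k)
  then have "w \<noteq> \<one>" by auto
  then obtain i u where i: "i \<in> I" "u \<in> carrier W" "w = s i \<otimes> u" "ell w = Suc (ell u)"
    using len_split_left [of I w] Suc.prems para_I by auto
  then have "T w v = T (s i) (T u v)" using T_ascend [of i u v] by simp
  then show ?case using Suc.hyps(1) [of u] Suc.hyps(2) i assms(1) by (simp add: stable_def)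
qed

text \<open>For \<open>w\<close> of maximal length with \<open>T\<^sub>w V\<close> not contained in \<open>U\<close>, every vector of \<open>T\<^sub>w V\<close>
  is a common eigenvector modulo \<open>U\<close>.\<close>

lemma eigenvector_exists:
  assumes "stable U" "stable V" "\<not> V \<subseteq> U"
  obtains v D where "v \<in> V" "v \<notin> U" "D \<subseteq> I" "eigen_mod U D v"
proof -
  define S where "S = {w \<in> carrier W. \<exists>v\<in>V. T w v \<notin> U}"
  have "finite S" using finite_W by (simp add: S_def)
  obtain v0 where "v0 \<in> V" "v0 \<notin> U" using assms(3) by blast
  then have "\<one> \<in> S"
    using stable_in_space [OF assms(2)] T_one [of v0] by (auto simp: S_def intro!: bexI [of _ v0])
  then have "Max (ell ` S) \<in> ell ` S" using \<open>finite S\<close> by (intro Max_in) auto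
  then obtain w where "w \<in> S" "ell w = Max (ell ` S)" by force
  then have w: "w \<in> S" "\<And>w'. w' \<in> S \<Longrightarrow> ell w' \<le> ell w"
    using \<open>finite S\<close> by auto
  then obtain v where v: "v \<in> V" "T w v \<notin> U" and wc: "w \<in> carrier W" by (auto simp: S_def)
  \<comment> \<open>Ascents lead out of \<open>S\<close> by maximality of \<open>w\<close>, so there
    the image lies in \<open>U\<close>; descents act by -1 exactly, by
    \<open>T_descend\<close>.\<close>
  have "eigen_mod U (descent_set w) (T w v)"
  proof (rule eigen_modI)
    fix i assume i: "i \<in> I" "i \<notin> descent_set w"
    then have up: "ell w < ell (s i \<otimes> w)" using descent_set_iff wc by blast
    then have "s i \<otimes> w \<notin> S" using w(2) by force
    then show "T (s i) (T w v) \<in> U" using T_ascend [OF i(1) wc up] v i wc by (simp add: S_def)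
  next
    fix i assume "i \<in> I" "i \<in> descent_set w"
    then have "T (s i) (T w v) + T w v = 0"
      using T_descend [of i w v] wc by (simp add: descent_set_def fun_eq_iff)
    then show "T (s i) (T w v) + T w v \<in> U"
      using fun_vs.subspace_0 stable_subspace assms(1) by metis
  qed
  moreover have "descent_set w \<subseteq> I" by (auto simp: descent_set_def)
  ultimately show ?thesis using that T_stable [OF assms(2) v(1) wc] v(2) by blast
qed

text \<open>Adjoining one eigenvector to \<open>U\<close> gives a submodule strictly above
  \<open>U\<close>, which simplicity makes all of \<open>V\<close>.\<close>

lemma simple_factor:
  assumes "stable U" "stable V" "U \<subset> V"
    and simple: "\<And>X. stable X \<Longrightarrow> U \<subseteq> X \<Longrightarrow> X \<subseteq> V \<Longrightarrow> X = U \<or> X = V"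
  obtains D where "D \<subseteq> I" "factor U V D"
proof -
  obtain v D where v: "v \<in> V" "v \<notin> U" "D \<subseteq> I" "eigen_mod U D v"
    using eigenvector_exists assms by blast
  have "stable (adjoin U v)"
    using stable_adjoin [OF assms(1) stable_in_space [OF assms(2)]] v by blast
  moreover have "adjoin U v \<subseteq> V" using adjoin_subset stable_subspace assms v by blast
  ultimately have "adjoin U v = U \<or> adjoin U v = V"
    using simple adjoin_base by blast
  then have "adjoin U v = V" using adjoin_self stable_subspace assms(1) v(2) by blast
  then show ?thesis using factor_adjoin [OF assms(1) v(2,4)] v(3) that by simp
qed

lemma factor_psubset: "factor U V D \<Longrightarrow> U \<subset> V"
  using adjoin_base by (auto simp: factor_def)

lemma factor_simple:
  assumes "factor U V D" "stable X" "U \<subseteq> X" "X \<subseteq> V"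
  shows "X = U \<or> X = V"
proof (rule disjCI)
  assume "X \<noteq> V"
  obtain v where v: "v \<notin> U" "V = adjoin U v" using assms(1) by (auto simp: factor_def)
  note sub = stable_subspace [OF assms(2)]
  have "x \<in> U" if "x \<in> X" for x
  proof (rule ccontr)
    assume "x \<notin> U"
    have "x \<in> adjoin U v" using that assms(4) v(2) by blast
    then obtain u c where u: "u \<in> U" "x = u + (\<lambda>z. c * v z)" by (rule adjoinE)
    then have "c \<noteq> 0" using \<open>x \<notin> U\<close> by (auto simp: plus_fun_def)
    then have "v = (\<lambda>z. inverse c * (x - u) z)" by (simp add: u fun_eq_iff)
    then have "v \<in> X"
      using fun_vs.subspace_scale [OF sub] fun_vs.subspace_diff [OF sub that] u(1) assms(3) by blast
    then show False using adjoin_subset [OF sub assms(3)] v(2) assms(4) \<open>X \<noteq> V\<close> by blast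
  qed
  then show "X = U" using assms(3) by blast
qed

text \<open>At an index in one label but not in the other, \<open>T (s i) v + v\<close> and
  \<open>T (s i) v\<close> would both lie in \<open>U\<close>, and with them
  \<open>v\<close>.\<close>

lemma factor_unique:
  assumes "stable U" "factor U V D" "factor U V D'" "D \<subseteq> I" "D' \<subseteq> I"
  shows "D = D'"
proof -
  have "D1 \<subseteq> D2" if fac: "factor U V D1" "factor U V D2" "D1 \<subseteq> I" for D1 D2
  proof
    fix i assume i: "i \<in> D1"
    show "i \<in> D2"
    proof (rule ccontr)
      assume n: "i \<notin> D2"
      obtain v where v: "v \<in> V" "v \<notin> U" using fac(1) unfolding factor_def by blast
      have "eigen_mod U D1 v" "eigen_mod U D2 v" "i \<in> I"
        using fac v i unfolding factor_def by blast+
      then have "T (s i) v + v \<in> U" "T (s i) v \<in> U"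
        using eigen_modD i n by blast+
      then have "(T (s i) v + v) - T (s i) v \<in> U"
        using fun_vs.subspace_diff stable_subspace assms(1) by blast
      then show False using v by simp
    qed
  qed
  then show ?thesis using assms by blast
qed

section \<open>Ranks of the averaging operators along a chain\<close>

lemma avg_stable:
  assumes "stable U" "v \<in> U" "J \<subseteq> I"
  shows "avg J v \<in> U"
proof -
  have "avg J v = (\<Sum>u\<in>para J. T u v)"
    using avg_eq_sum_T [OF assms(3), of v] by (simp add: fun_eq_iff sum_fun_apply)
  then show ?thesis
    using T_stable [OF assms(1,2)] para_closed [OF assms(3)] stable_subspace [OF assms(1)]
    by (metis fun_vs.subspace_sum)
qed

text \<open>The rightmost letter of a reduced word of \<open>u\<close> acts first; it lies in
  \<open>J\<close>, so outside \<open>D\<close>, and sends \<open>v\<close> into \<open>U\<close>.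
  The other letters keep it there.\<close>

lemma T_para_factor:
  assumes "stable U" "stable V" "factor U V D" "J \<subseteq> I" "D \<inter> J = {}" "v \<in> V" "u \<in> para J" "u \<noteq> \<one>"
  shows "T u v \<in> U"
  using assms(7,8)
proof (induction "len J u" arbitrary: u)
  case 0
  then show ?case using len_eq_0 by simp
next
  case (Suc k)
  obtain i w where i: "i \<in> J" "w \<in> para J" "u = s i \<otimes> w" "len J u = Suc (len J w)"
    using len_split_left [OF assms(4) Suc.prems] by blast
  have iI: "i \<in> I" "w \<in> carrier W" using i assms(4) para_closed by auto
  have "ell w < ell (s i \<otimes> w)"
    using ell_para [OF assms(4)] i Suc.prems by simp
  then have Tu: "T u v = T (s i) (T w v)" using T_ascend iI i(3) by simp
  show ?case
  proof (cases "w = \<one>")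
    case True
    have "T w v = v" using T_one True assms(2,6) by (auto simp: stable_def)
    moreover have "i \<notin> D" using i(1) assms(5) by blast
    ultimately show ?thesis using Tu eigen_modD(1) [of U D v i] assms(3,6) iI by (simp add: factor_def)
  next
    case False
    then have "T w v \<in> U" using Suc i by simp
    then show ?thesis using Tu assms(1) iI by (simp add: stable_def)
  qed
qed

text \<open>In the sum of all \<open>T u\<close> only \<open>T \<one>\<close> survives modulo
  \<open>U\<close>.\<close>

lemma avg_factor_id:
  assumes "stable U" "stable V" "factor U V D" "J \<subseteq> I" "D \<inter> J = {}" "v \<in> V"
  shows "avg J v - v \<in> U"
proof -
  have fin: "finite (para J)" using finite_W para_subset [OF assms(4)] finite_subset by blast
  have "avg J v = (\<Sum>u\<in>para J. T u v)"
    using avg_eq_sum_T [OF assms(4), of v] by (simp add: fun_eq_iff sum_fun_apply)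
  also have "\<dots> = T \<one> v + (\<Sum>u\<in>para J - {\<one>}. T u v)"
    using fin by (intro sum.remove) auto
  also have "T \<one> v = v" using T_one assms(2,6) by (auto simp: stable_def)
  finally have "avg J v - v = (\<Sum>u\<in>para J - {\<one>}. T u v)"
    by (simp only: add_diff_cancel_left')
  moreover have "(\<Sum>u\<in>para J - {\<one>}. T u v) \<in> U"
    using T_para_factor [OF assms] stable_subspace [OF assms(1)] by (intro fun_vs.subspace_sum) auto
  ultimately show ?thesis by simp
qed

text \<open>For \<open>i\<close> in both sets, \<open>T (s i)\<close> kills \<open>avg J v\<close>
  because it is an invariant, yet acts on it as -1 modulo \<open>U\<close>.\<close>

lemma avg_factor_zero:
  assumes "stable U" "stable V" "factor U V D" "J \<subseteq> I" "D \<inter> J \<noteq> {}" "v \<in> V"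
  shows "avg J v \<in> U"
proof -
  obtain i where i: "i \<in> D" "i \<in> J" "i \<in> I" using assms(4,5) by blast
  have "eigen_mod U D (avg J v)"
    using assms avg_stable by (auto simp: factor_def)
  then have "T (s i) (avg J v) + avg J v \<in> U" using eigen_modD(2) i by blast
  moreover have "T (s i) (avg J v) = (\<lambda>_. 0)"
    using T_invariant [OF assms(4) i(2)] avg_in_invariants [OF assms(4)] by blast
  ultimately show ?thesis by (simp add: plus_fun_def)
qed

text \<open>A labelled series with one-dimensional factors, where \<open>D j\<close> belongs to the
  step from \<open>V j\<close> to \<open>V (Suc j)\<close>. Values beyond \<open>n\<close> are
  arbitrary, so that a chain can be extended by function update.\<close>

definition chain :: "(nat \<Rightarrow> ('c \<Rightarrow> 'f) set) \<Rightarrow> (nat \<Rightarrow> 'i set) \<Rightarrow> nat \<Rightarrow> bool" where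
  "chain V D n \<longleftrightarrow> V 0 = {\<lambda>_. 0} \<and> (\<forall>j\<le>n. stable (V j)) \<and>
     (\<forall>j<n. D j \<subseteq> I \<and> factor (V j) (V (Suc j)) (D j))"

text \<open>By \<open>avg_factor_id\<close> and \<open>avg_factor_zero\<close>, the image under
  \<open>avg J\<close> gains one dimension at each step whose label avoids \<open>J\<close> and none
  at the others.\<close>

lemma chain_avg_basis:
  assumes "chain V D n" "J \<subseteq> I"
  shows "\<exists>B. finite B \<and> fun_vs.independent B \<and> B \<subseteq> avg J ` V n \<and> avg J ` V n \<subseteq> fun_vs.span B \<and>
             card B = card {j. j < n \<and> D j \<inter> J = {}}"
  using assms(1)
proof (induction n)
  case 0
  have "avg J (\<lambda>_. 0) = 0" by (simp add: avg_def fun_eq_iff)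
  then have "avg J ` V 0 \<subseteq> fun_vs.span {}"
    using 0 by (simp add: chain_def)
  then show ?case by (intro exI [of _ "{}"]) (auto simp: fun_vs.independent_empty)
next
  case (Suc n)
  let ?U = "V n" and ?V = "V (Suc n)"
  from Suc have "chain V D n" by (auto simp: chain_def)
  then obtain B where B: "finite B" "fun_vs.independent B" "B \<subseteq> avg J ` ?U"
    "avg J ` ?U \<subseteq> fun_vs.span B" "card B = card {j. j < n \<and> D j \<inter> J = {}}"
    using Suc.IH by blast
  have st: "stable ?U" "stable ?V" and fac: "factor ?U ?V (D n)"
    using Suc.prems by (auto simp: chain_def)
  have UV: "?U \<subseteq> ?V" using factor_psubset fac by blast
  obtain v where v: "v \<in> ?V" "v \<notin> ?U" "?V = adjoin ?U v" using fac by (auto simp: factor_def)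
  show ?case
  proof (cases "D n \<inter> J = {}")
    case True
    let ?b = "avg J v"
    \<comment> \<open>\<open>avg J v\<close> is congruent to \<open>v\<close> modulo
      \<open>?U\<close>, so it lies outside \<open>?U\<close>, which contains the span of the
      earlier basis.\<close>
    have "?b \<notin> ?U"
    proof
      assume "?b \<in> ?U"
      then have "?b - (?b - v) \<in> ?U"
        using avg_factor_id [OF st fac assms(2) True v(1)] fun_vs.subspace_diff stable_subspace st
        by blast
      then show False using v by simp
    qed
    moreover have "fun_vs.span B \<subseteq> ?U"
      using B(3) avg_stable [OF st(1) _ assms(2)] stable_subspace [OF st(1)]
      by (intro fun_vs.span_minimal) auto
    ultimately have nb: "?b \<notin> fun_vs.span B" by blast
    then have nB: "?b \<notin> B" using fun_vs.span_base by blast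
    have "{j. j < Suc n \<and> D j \<inter> J = {}} = insert n {j. j < n \<and> D j \<inter> J = {}}"
      using True by (auto simp: less_Suc_eq)
    then have "card (insert ?b B) = card {j. j < Suc n \<and> D j \<inter> J = {}}"
      using B nB by simp
    moreover have "avg J ` ?V \<subseteq> fun_vs.span (insert ?b B)"
    proof
      fix y assume "y \<in> avg J ` ?V"
      then obtain u c where u: "u \<in> ?U" "y = avg J (u + (\<lambda>z. c * v z))"
        using v(3) by (auto elim!: adjoinE)
      then have y: "y = avg J u + (\<lambda>z. c * ?b z)" by (simp add: avg_add avg_scale)
      have "avg J u \<in> fun_vs.span (insert ?b B)"
        using u(1) B(4) fun_vs.span_mono [of B "insert ?b B"] by blast
      moreover have "(\<lambda>z. c * ?b z) \<in> fun_vs.span (insert ?b B)"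
        by (intro fun_vs.span_scale fun_vs.span_base) simp
      ultimately show "y \<in> fun_vs.span (insert ?b B)" unfolding y by (rule fun_vs.span_add)
    qed
    moreover have "insert ?b B \<subseteq> avg J ` ?V" using B(3) UV v(1) by blast
    moreover have "fun_vs.independent (insert ?b B)"
      using B(2) nb by (simp add: fun_vs.independent_insert)
    ultimately show ?thesis using B(1) by (intro exI [of _ "insert ?b B"]) simp
  next
    case False
    \<comment> \<open>Here \<open>avg J\<close> sends \<open>?V\<close> into \<open>?U\<close>;
      being idempotent, it has the same image on both.\<close>
    have "avg J x \<in> avg J ` ?U" if "x \<in> ?V" for x
    proof -
      have "avg J x \<in> ?U" using avg_factor_zero st fac assms(2) False that by blast
      moreover have "avg J (avg J x) = avg J x"
        using avg_invariant avg_in_invariants assms(2) by blast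
      ultimately show ?thesis by (metis imageI)
    qed
    then have "avg J ` ?V = avg J ` ?U" using UV by blast
    moreover have "{j. j < Suc n \<and> D j \<inter> J = {}} = {j. j < n \<and> D j \<inter> J = {}}"
      using False by (auto simp: less_Suc_eq)
    ultimately show ?thesis using B by (intro exI [of _ B]) simp
  qed
qed

section \<open>Counting residues by minimal distances\<close>

definition class_ind :: "'c set \<Rightarrow> 'c \<Rightarrow> 'f" where
  "class_ind K = (\<lambda>z. if z \<in> K then 1 else 0)"

lemma inj_class_ind: "inj class_ind"
  by (rule injI) (metis class_ind_def one_neq_zero subsetI subset_antisym)

lemma invariants_basis:
  assumes "J \<subseteq> I"
  defines "B \<equiv> class_ind ` (\<Omega> // adjacent J)"
  shows "finite B" "fun_vs.independent B" "B \<subseteq> invariants J" "invariants J \<subseteq> fun_vs.span B"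
    "card B = card (\<Omega> // adjacent J)"
proof -
  note eq = equiv_adjacent [OF assms(1)]
  have finQ: "finite (\<Omega> // adjacent J)"
    using finite_chambers eq by (intro finite_quotient) (auto simp: equiv_def)
  then show fin: "finite B" by (simp add: B_def)
  show "card B = card (\<Omega> // adjacent J)"
    unfolding B_def using inj_class_ind by (intro card_image) (auto intro: inj_on_subset)
  \<comment> \<open>Classes are disjoint, so evaluation at a point of \<open>K0\<close> isolates the
    coefficient of \<open>K0\<close>. This serves both independence and spanning.\<close>
  have val: "(\<Sum>K\<in>\<Omega> // adjacent J. f K * class_ind K z) = f K0"
    if "K0 \<in> \<Omega> // adjacent J" "z \<in> K0" for f K0 z
  proof -
    have "(\<Sum>K\<in>\<Omega> // adjacent J. f K * class_ind K z) = (\<Sum>K\<in>\<Omega> // adjacent J. if K = K0 then f K else 0)"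
    proof (rule sum.cong [OF refl])
      fix K assume "K \<in> \<Omega> // adjacent J"
      then have "z \<in> K \<longleftrightarrow> K = K0" using quotient_disj [OF eq _ that(1)] that(2) by blast
      then show "f K * class_ind K z = (if K = K0 then f K else 0)" by (simp add: class_ind_def)
    qed
    then show ?thesis using finQ that(1) by simp
  qed
  show "fun_vs.independent B"
  proof (rule fun_vs.independent_if_scalars_zero [OF fin])
    fix f x assume 0: "(\<Sum>x\<in>B. (\<lambda>z. f x * x z)) = 0" and "x \<in> B"
    then obtain K where K: "K \<in> \<Omega> // adjacent J" "x = class_ind K" by (auto simp: B_def)
    obtain z where z: "z \<in> K" using K(1) eq in_quotient_imp_non_empty by blast
    have "0 = (\<Sum>x\<in>B. f x * x z)" using fun_cong [OF 0, of z] by (simp add: sum_fun_apply)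
    also have "\<dots> = (\<Sum>K\<in>\<Omega> // adjacent J. f (class_ind K) * class_ind K z)"
      unfolding B_def using inj_class_ind by (subst sum.reindex) (auto intro: inj_on_subset)
    also have "\<dots> = f x" using val [OF K(1) z, of "\<lambda>K. f (class_ind K)"] K(2) by simp
    finally show "f x = 0" by simp
  qed
  show "B \<subseteq> invariants J"
  proof
    fix b assume "b \<in> B"
    then obtain K where K: "K \<in> \<Omega> // adjacent J" "b = class_ind K" by (auto simp: B_def)
    have "K \<subseteq> \<Omega>" using in_quotient_imp_subset [OF eq K(1)] .
    moreover have "x \<in> K \<longleftrightarrow> y \<in> K" if "(x, y) \<in> adjacent J" for x y
      using in_quotient_imp_closed [OF eq K(1)] that eq by (meson equivE symD)
    ultimately show "b \<in> invariants J" by (auto simp: K(2) class_ind_def invariants_def space_def)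
  qed
  show "invariants J \<subseteq> fun_vs.span B"
  proof
    fix v assume v: "v \<in> invariants J"
    define f where "f K = v (SOME z. z \<in> K)" for K
    have "v = (\<Sum>K\<in>\<Omega> // adjacent J. (\<lambda>z. f K * class_ind K z))"
    proof
      fix z
      show "v z = (\<Sum>K\<in>\<Omega> // adjacent J. (\<lambda>z. f K * class_ind K z)) z"
      proof (cases "z \<in> \<Omega>")
        case True
        let ?K = "adjacent J `` {z}"
        have K: "?K \<in> \<Omega> // adjacent J" "z \<in> ?K"
          using True equiv_class_self [OF eq True] by (auto intro: quotientI)
        have "(SOME y. y \<in> ?K) \<in> ?K" using K(2) by (rule someI)
        then have "f ?K = v z" using v by (force simp: f_def invariants_def)
        then show ?thesis using val [OF K, of f] by (simp add: sum_fun_apply)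
      next
        case False
        then have "class_ind K z = 0" if "K \<in> \<Omega> // adjacent J" for K
          using in_quotient_imp_subset [OF eq that] by (auto simp: class_ind_def)
        moreover have "v z = 0" using v False by (auto simp: invariants_def space_def)
        ultimately show ?thesis by (simp add: sum_fun_apply)
      qed
    qed
    moreover have "(\<Sum>K\<in>\<Omega> // adjacent J. (\<lambda>z. f K * class_ind K z)) \<in> fun_vs.span B"
      by (intro fun_vs.span_sum fun_vs.span_scale fun_vs.span_base) (auto simp: B_def)
    ultimately show "v \<in> fun_vs.span B" by simp
  qed
qed

text \<open>By \<open>ell_mult_minimal\<close> every step of a reduced walk from \<open>y\<close>
  inside its residue is an ascent as seen from \<open>x\<close>, so each letter multiplies the
  distance: \<open>y\<close> is the projection of \<open>x\<close> to the residue.\<close>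

lemma dist_minimal:
  assumes "x \<in> \<Omega>" "y \<in> \<Omega>" "z \<in> \<Omega>" "J \<subseteq> I" "\<delta> y z \<in> para J" "descent_set (\<delta> x y) \<inter> J = {}"
  shows "\<delta> x z = \<delta> y z \<otimes> \<delta> x y"
  using assms
proof (induction "len J (\<delta> y z)" arbitrary: z)
  case 0
  then have "\<delta> y z = \<one>" using len_eq_0 by simp
  then show ?case using 0 dist_one by simp
next
  case (Suc k)
  then have "\<delta> y z \<noteq> \<one>" by auto
  then obtain i u where i: "i \<in> J" "u \<in> para J" "\<delta> y z = s i \<otimes> u" "len J (\<delta> y z) = Suc (len J u)"
    using len_split_left [OF Suc.prems(4,5)] by blast
  have iI: "i \<in> I" "u \<in> carrier W" using i Suc.prems para_closed by auto
  obtain z' where z': "z' \<in> \<Omega>" "\<delta> z z' = s i" "\<delta> y z' = s i \<otimes> \<delta> y z"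
    using dist_reach [of y z i] Suc.prems iI by blast
  have u: "\<delta> y z' = u" using z' i iI by simp
  then have xz': "\<delta> x z' = u \<otimes> \<delta> x y"
    using Suc.hyps(1) [of z'] Suc.hyps(2) Suc.prems z' i by simp
  have eq: "s i \<otimes> \<delta> x z' = \<delta> y z \<otimes> \<delta> x y" using xz' i(3) iI Suc.prems by (simp add: m_assoc)
  have "ell (\<delta> x z') < ell (s i \<otimes> \<delta> x z')"
    unfolding eq using ell_mult_minimal [of J "\<delta> x y"] Suc.prems i xz' by simp
  then show ?case
    using dist_ascend [of x z' z i] Suc.prems z' iI dist_sym [of z z' i] eq by simp
qed

text \<open>Each residue has exactly one chamber whose distance from a fixed \<open>x\<close> has no
  descent in \<open>J\<close>; these chambers are counted sphere by sphere.\<close>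

lemma card_classes:
  assumes "J \<subseteq> I"
  shows "card (\<Omega> // adjacent J) = (\<Sum>w | w \<in> carrier W \<and> descent_set w \<inter> J = {}. q ^ ell w)"
proof -
  note eq = equiv_adjacent [OF assms]
  obtain x where x: "x \<in> \<Omega>" using chambers_nonempty by blast
  let ?X = "{w. w \<in> carrier W \<and> descent_set w \<inter> J = {}}"
  define M where "M = {y \<in> \<Omega>. descent_set (\<delta> x y) \<inter> J = {}}"
  have "bij_betw (\<lambda>y. adjacent J `` {y}) M (\<Omega> // adjacent J)"
  proof (rule bij_betw_imageI)
    show "inj_on (\<lambda>y. adjacent J `` {y}) M"
    proof (rule inj_onI)
      fix y z assume y: "y \<in> M" and z: "z \<in> M" and "adjacent J `` {y} = adjacent J `` {z}"
      then have yz: "\<delta> y z \<in> para J"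
        using eq_equiv_class [OF _ eq, of y z] by (auto simp: adjacent_def M_def)
      have "\<delta> x z = \<delta> y z \<otimes> \<delta> x y"
        using dist_minimal [OF x _ _ assms yz] y z by (simp add: M_def)
      then have "\<delta> y z = \<one>"
        using minimal_unique [OF assms, of "\<delta> x y" "\<delta> y z"] y z x yz by (simp add: M_def)
      then show "y = z" using y z dist_one by (simp add: M_def)
    qed
    show "(\<lambda>y. adjacent J `` {y}) ` M = \<Omega> // adjacent J"
    proof (intro equalityI subsetI)
      fix K assume "K \<in> (\<lambda>y. adjacent J `` {y}) ` M"
      then show "K \<in> \<Omega> // adjacent J" by (auto simp: M_def intro: quotientI)
    next
      fix K assume K: "K \<in> \<Omega> // adjacent J"
      then obtain k where "k \<in> K" using eq in_quotient_imp_non_empty by blast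
      then obtain y where y: "y \<in> K" "\<And>z. z \<in> K \<Longrightarrow> ell (\<delta> x y) \<le> ell (\<delta> x z)"
        using ex_has_least_nat [of "\<lambda>z. z \<in> K" k "\<lambda>z. ell (\<delta> x z)"] by blast
      have yO: "y \<in> \<Omega>" using in_quotient_imp_subset [OF eq K] y by blast
      have Ky: "K = adjacent J `` {y}"
        using K
      proof (rule quotientE)
        fix w assume "K = adjacent J `` {w}"
        with y(1) show "K = adjacent J `` {y}" using equiv_class_eq [OF eq, of w y] by auto
      qed
      \<comment> \<open>The chamber of \<open>K\<close> nearest to \<open>x\<close> qualifies: a
        descent in \<open>J\<close> would be realised by a nearer neighbour, again in
        \<open>K\<close>.\<close>
      have "descent_set (\<delta> x y) \<inter> J = {}"
      proof (rule ccontr)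
        assume "descent_set (\<delta> x y) \<inter> J \<noteq> {}"
        then obtain i where i: "i \<in> J" "i \<in> I" "ell (s i \<otimes> \<delta> x y) < ell (\<delta> x y)"
          by (auto simp: descent_set_def)
        obtain z where z: "z \<in> \<Omega>" "\<delta> y z = s i" "\<delta> x z = s i \<otimes> \<delta> x y"
          using dist_reach [OF x yO i(2)] by blast
        then have "z \<in> K" using Ky yO s_in_para [OF assms i(1)] by (simp add: adjacent_def)
        then show False using y(2) [of z] z i by simp
      qed
      then show "K \<in> (\<lambda>y. adjacent J `` {y}) ` M" using Ky yO by (auto simp: M_def)
    qed
  qed
  then have "card (\<Omega> // adjacent J) = card M" by (metis bij_betw_same_card)
  also have "M = (\<Union>w\<in>?X. {y \<in> \<Omega>. \<delta> x y = w})" using x by (auto simp: M_def)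
  also have "card \<dots> = (\<Sum>w\<in>?X. card {y \<in> \<Omega>. \<delta> x y = w})"
    using finite_W finite_chambers by (intro card_UN_disjoint) auto
  also have "\<dots> = (\<Sum>w\<in>?X. q ^ ell w)" using sphere_card x by (intro sum.cong) auto
  finally show ?thesis .
qed

text \<open>The rank of the projection \<open>avg J\<close> is computed twice, along the chain and
  from its image \<open>invariants J\<close>.\<close>

lemma chain_count:
  assumes "chain V D n" "V n = space" "J \<subseteq> I"
  shows "card {j. j < n \<and> D j \<inter> J = {}} = (\<Sum>w | w \<in> carrier W \<and> descent_set w \<inter> J = {}. q ^ ell w)"
proof -
  obtain B where B: "finite B" "fun_vs.independent B" "B \<subseteq> avg J ` space"
    "avg J ` space \<subseteq> fun_vs.span B" "card B = card {j. j < n \<and> D j \<inter> J = {}}"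
    using chain_avg_basis [OF assms(1,3)] assms(2) by auto
  have "avg J ` space = invariants J"
  proof (intro equalityI subsetI)
    fix v assume "v \<in> invariants J"
    then have "avg J v = v" "v \<in> space" using avg_invariant assms(3) by (auto simp: invariants_def)
    then show "v \<in> avg J ` space" by (metis imageI)
  qed (use avg_in_invariants assms(3) in blast)
  then have "card {j. j < n \<and> D j \<inter> J = {}} = fun_vs.dim (invariants J)"
    using fun_vs.dim_unique [OF _ _ B(2) B(5)] B(3,4) by simp
  also have "\<dots> = card (\<Omega> // adjacent J)"
    by (rule fun_vs.dim_unique [OF invariants_basis(3,4,2,5) [OF assms(3)]])
  finally show ?thesis using card_classes assms(3) by simp
qed

text \<open>\<open>chain_count\<close> with \<open>J = I - E'\<close> counts the labels,
  respectively weighs the descent sets, contained in \<open>E'\<close>; doing so for all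
  \<open>E' \<subseteq> E\<close> isolates those equal to \<open>E\<close>.\<close>

lemma chain_multiplicity:
  assumes "chain V D n" "V n = space" "E \<subseteq> I"
  shows "card {j. j < n \<and> D j = E} = (\<Sum>w | w \<in> carrier W \<and> descent_set w = E. q ^ ell w)"
proof (rule eq_of_lower_sums_eq [where f = "\<lambda>E. card {j. j < n \<and> D j = E}" and D = E])
  show "finite E" using assms(3) finite_I finite_subset by blast
next
  fix E' assume "E' \<subseteq> E"
  then have "E' \<subseteq> I" using assms(3) by blast
  then have E': "finite (Pow E')" using finite_subset [OF _ finite_I] by simp
  have DI: "D j \<inter> (I - E') = {} \<longleftrightarrow> D j \<in> Pow E'" if "j < n" for j
  proof -
    have "D j \<subseteq> I" using assms(1) that by (simp add: chain_def)
    then show ?thesis by blast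
  qed
  have dI: "descent_set w \<inter> (I - E') = {} \<longleftrightarrow> descent_set w \<in> Pow E'" for w
    by (auto simp: descent_set_def)
  have "(\<Sum>F\<in>Pow E'. card {j. j < n \<and> D j = F}) = card (\<Union>F\<in>Pow E'. {j. j < n \<and> D j = F})"
    using E' by (intro card_UN_disjoint [symmetric]) auto
  also have "(\<Union>F\<in>Pow E'. {j. j < n \<and> D j = F}) = {j. j < n \<and> D j \<inter> (I - E') = {}}"
    using DI by auto
  also have "card \<dots> = (\<Sum>w | w \<in> carrier W \<and> descent_set w \<inter> (I - E') = {}. q ^ ell w)"
    using chain_count [OF assms(1,2)] by simp
  also have "{w. w \<in> carrier W \<and> descent_set w \<inter> (I - E') = {}} =
      (\<Union>F\<in>Pow E'. {w. w \<in> carrier W \<and> descent_set w = F})"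
    using dI by auto
  also have "(\<Sum>w\<in>\<dots>. q ^ ell w) = (\<Sum>F\<in>Pow E'. \<Sum>w | w \<in> carrier W \<and> descent_set w = F. q ^ ell w)"
    using E' finite_W by (intro sum.UNION_disjoint) auto
  finally show "(\<Sum>F\<in>Pow E'. card {j. j < n \<and> D j = F}) =
      (\<Sum>F\<in>Pow E'. \<Sum>w | w \<in> carrier W \<and> descent_set w = F. q ^ ell w)" .
qed

section \<open>Existence of a full chain\<close>

lemma chain_extend:
  assumes "chain V D n" "V n \<noteq> space"
  shows "\<exists>V' D'. chain V' D' (Suc n)"
proof -
  have st: "stable (V n)" using assms(1) by (simp add: chain_def)
  then have "\<not> space \<subseteq> V n" using assms(2) by (auto simp: stable_def)
  then obtain v E where v: "v \<in> space" "v \<notin> V n" "E \<subseteq> I" "eigen_mod (V n) E v"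
    using eigenvector_exists [OF st stable_space] by blast
  have "chain (V(Suc n := adjoin (V n) v)) (D(n := E)) (Suc n)"
    using assms(1) stable_adjoin [OF st v(1,4)] factor_adjoin [OF st v(2,4)] v(3)
    by (auto simp: chain_def le_Suc_eq less_Suc_eq)
  then show ?thesis by blast
qed

text \<open>With \<open>J = {}\<close> every step counts, so the length of a chain is at most the
  dimension of \<open>invariants {}\<close>.\<close>

lemma chain_bounded:
  assumes "chain V D n"
  shows "n \<le> card (\<Omega> // adjacent {})"
proof -
  obtain B where B: "fun_vs.independent B" "B \<subseteq> avg {} ` V n" "card B = n"
    using chain_avg_basis [OF assms, of "{}"] by auto
  have "B \<subseteq> invariants {}" using B(2) avg_in_invariants by blast
  then have "B \<subseteq> fun_vs.span (class_ind ` (\<Omega> // adjacent {}))"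
    using invariants_basis(4) [of "{}"] by auto
  then show ?thesis
    using fun_vs.independent_span_bound [OF invariants_basis(1) B(1)] invariants_basis(5) [of "{}"] B(3)
    by (metis empty_subsetI)
qed

text \<open>A chain of greatest length cannot be extended, so it ends in the whole space.\<close>

lemma full_chain_exists:
  obtains V D n where "chain V D n" "V n = space"
proof -
  let ?P = "\<lambda>n. \<exists>V D. chain V D n"
  have "?P 0" by (auto simp: chain_def stable_zero intro!: exI [of _ "\<lambda>_. {\<lambda>_. 0}"])
  moreover have bound: "\<And>n. ?P n \<Longrightarrow> n \<le> card (\<Omega> // adjacent {})"
    using chain_bounded by blast
  ultimately have "?P (GREATEST n. ?P n)" by (rule GreatestI_nat)
  then obtain V D where VD: "chain V D (GREATEST n. ?P n)" by blast
  have "\<not> ?P (Suc (GREATEST n. ?P n))"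
    using Greatest_le_nat [of ?P "Suc (GREATEST n. ?P n)", OF _ bound] Suc_n_not_le_n by blast
  then have "V (GREATEST n. ?P n) = space" using chain_extend [OF VD] by blast
  then show ?thesis by (rule that [OF VD])
qed

end

section \<open>The building of a BN-pair\<close>

locale BN_pair =
  fixes G :: "('a, 'b) monoid_scheme" (structure) and B N :: "'a set" and s :: "nat \<Rightarrow> 'a set"
    and r q :: nat
  assumes BN: "split_BN_pair G B N s r q" and thick: "2 \<le> q"
begin

sublocale group G
  using BN by (simp add: split_BN_pair_def)

abbreviation H :: "'a set" where "H \<equiv> torus B N"

abbreviation Wg :: "'a set monoid" where "Wg \<equiv> G\<lparr>carrier := N\<rparr> Mod H"

lemma B_subgroup: "subgroup B G" and N_subgroup: "subgroup N G"
  and H_normal: "H \<lhd> G\<lparr>carrier := N\<rparr>" and finite_G: "finite (carrier G)"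
  and generate_BN: "generate G (B \<union> N) = carrier G"
  and gen_in_weyl: "i \<in> {1..r} \<Longrightarrow> s i \<in> weyl G B N"
  and gen_ne_one: "i \<in> {1..r} \<Longrightarrow> s i \<noteq> H"
  and gen_square: "i \<in> {1..r} \<Longrightarrow> s i <#> s i = H"
  and weyl_generated: "w \<in> weyl G B N \<Longrightarrow> \<exists>is. set is \<subseteq> {1..r} \<and> wprod G H s is = w"
  and BN_axiom: "i \<in> {1..r} \<Longrightarrow> w \<in> weyl G B N \<Longrightarrow>
        s i <#> B <#> w \<subseteq> (B <#> w <#> B) \<union> (B <#> (s i <#> w) <#> B)"
  and panel_size: "i \<in> {1..r} \<Longrightarrow> card (B <#> s i <#> B) = q * card B"
  using BN by (simp_all add: split_BN_pair_def)

interpretation B: subgroup B G by (rule B_subgroup)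
interpretation N: subgroup N G by (rule N_subgroup)
interpretation H: normal H "G\<lparr>carrier := N\<rparr>" by (rule H_normal)

lemma Wg_simps [simp]: "carrier Wg = weyl G B N" "x \<otimes>\<^bsub>Wg\<^esub> y = x <#> y" "\<one>\<^bsub>Wg\<^esub> = H"
  by (simp_all add: FactGroup_def weyl_def)

lemma group_Wg: "group Wg"
  by (rule H.factorgroup_is_group)

lemma word_eq_wprod: "foldr (\<lambda>i x. s i \<otimes>\<^bsub>Wg\<^esub> x) ws \<one>\<^bsub>Wg\<^esub> = wprod G H s ws"
  by (simp add: wprod_def)

sublocale W: involution_generated Wg "{1..r}" s
proof -
  interpret Wg: group Wg by (rule group_Wg)
  show "involution_generated Wg {1..r} s"
  proof unfold_locales
    fix w assume "w \<in> carrier Wg"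
    then show "\<exists>ws. set ws \<subseteq> {1..r} \<and> foldr (\<lambda>i x. s i \<otimes>\<^bsub>Wg\<^esub> x) ws \<one>\<^bsub>Wg\<^esub> = w"
      unfolding word_eq_wprod using weyl_generated by simp
  qed (use gen_in_weyl gen_square in auto)
qed

lemma word_wprod: "W.word ws = wprod G H s ws"
  unfolding W.word_def by (rule word_eq_wprod)

lemma len_wlen: "W.len {1..r} w = wlen G H s r w"
  by (simp add: W.len_def wlen_def word_wprod)

lemma H_subset: "H \<subseteq> B" "H \<subseteq> N"
  by (auto simp: torus_def)

lemma H_subgroup: "subgroup H G"
  using subgroups_Inter_pair [OF B_subgroup N_subgroup] by (simp add: torus_def)

lemma one_in_H: "\<one> \<in> H"
  by (simp add: torus_def)

lemma H_in_weyl: "H \<in> weyl G B N"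
  using W.one_closed by simp

lemma weyl_coset:
  assumes w: "w \<in> weyl G B N" "n \<in> w"
  shows "n \<in> N \<and> w = H #> n"
proof -
  obtain m where m: "m \<in> N" "w = H #> m" using w by (auto simp: weyl_def RCOSETS_def)
  have "n \<in> N" using w m H_subset by (auto simp: r_coset_def)
  moreover have "H #> m = H #> n"
    using repr_independence [of n H m] w m H_subgroup by simp
  ultimately show ?thesis using m by simp
qed

lemma coset_in_weyl: "n \<in> N \<Longrightarrow> H #> n \<in> weyl G B N \<and> n \<in> H #> n"
  using rcos_self [of n H] H_subgroup by (auto simp: weyl_def RCOSETS_def)

lemma weyl_nonempty:
  assumes "w \<in> weyl G B N"
  obtains n where "n \<in> w" "n \<in> N" "n \<in> carrier G"
proof -
  obtain m where "m \<in> N" "w = H #> m" using assms by (auto simp: weyl_def RCOSETS_def)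
  then show ?thesis using that coset_in_weyl [of m] by auto
qed

lemma weyl_memD: "w \<in> weyl G B N \<Longrightarrow> n \<in> w \<Longrightarrow> n \<in> carrier G"
  using weyl_coset by auto

lemma weyl_mult: "u \<in> weyl G B N \<Longrightarrow> w \<in> weyl G B N \<Longrightarrow> u <#> w \<in> weyl G B N"
  using W.m_closed by simp

section \<open>Bruhat decomposition\<close>

definition cell :: "'a set \<Rightarrow> 'a set" where
  "cell w = B <#> w <#> B"

definition dc :: "'a \<Rightarrow> 'a set" where
  "dc x = {b \<otimes> x \<otimes> b' | b b'. b \<in> B \<and> b' \<in> B}"

text \<open>The torus lies in \<open>B\<close> and is absorbed by it, so any representative of
  \<open>w\<close> gives the same double coset.\<close>

lemma cell_eq_dc:
  assumes "w \<in> weyl G B N" "n \<in> w" shows "cell w = dc n"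
proof -
  have n: "n \<in> carrier G" "w = H #> n" using weyl_coset [OF assms] by auto
  show ?thesis
  proof (intro equalityI subsetI)
    fix x assume "x \<in> cell w"
    then obtain b h b' where b: "b \<in> B" "h \<in> H" "b' \<in> B" "x = b \<otimes> (h \<otimes> n) \<otimes> b'"
      using n(2) by (auto simp: cell_def set_mult_def r_coset_def)
    then have "x = (b \<otimes> h) \<otimes> n \<otimes> b'" "b \<otimes> h \<in> B"
      using n H_subset by (auto simp: m_assoc subset_iff)
    then show "x \<in> dc n" using b by (auto simp: dc_def)
  next
    fix x assume "x \<in> dc n"
    then show "x \<in> cell w" using assms(2) by (auto simp: cell_def set_mult_def dc_def)
  qed
qed

lemma dc_self: "x \<in> carrier G \<Longrightarrow> x \<in> dc x"
  unfolding dc_def by (intro CollectI exI [of _ \<one>]) auto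

lemma dc_carrier: "x \<in> carrier G \<Longrightarrow> y \<in> dc x \<Longrightarrow> y \<in> carrier G"
  by (auto simp: dc_def)

lemma dc_subset:
  assumes "x \<in> carrier G" "y \<in> dc x" shows "dc y \<subseteq> dc x"
proof
  obtain b b' where b: "b \<in> B" "b' \<in> B" "y = b \<otimes> x \<otimes> b'" using assms by (auto simp: dc_def)
  fix z assume "z \<in> dc y"
  then obtain c c' where c: "c \<in> B" "c' \<in> B" "z = c \<otimes> y \<otimes> c'" by (auto simp: dc_def)
  then have "z = (c \<otimes> b) \<otimes> x \<otimes> (b' \<otimes> c')" using b assms(1) by (simp add: m_assoc)
  moreover have "c \<otimes> b \<in> B" "b' \<otimes> c' \<in> B" using b c by auto
  ultimately show "z \<in> dc x" unfolding dc_def by blast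
qed

lemma dc_eq:
  assumes "x \<in> carrier G" "y \<in> dc x" shows "dc y = dc x"
proof -
  obtain b b' where b: "b \<in> B" "b' \<in> B" "y = b \<otimes> x \<otimes> b'" using assms by (auto simp: dc_def)
  then have "x = inv b \<otimes> y \<otimes> inv b'"
    using assms(1) by (simp add: m_assoc) (simp add: m_assoc [symmetric])
  then have "x \<in> dc y" using b unfolding dc_def by blast
  then show ?thesis using dc_subset assms dc_carrier by blast
qed

lemma cell_carrier: "w \<in> weyl G B N \<Longrightarrow> x \<in> cell w \<Longrightarrow> x \<in> carrier G"
  using weyl_nonempty [of w] cell_eq_dc dc_carrier by metis

lemma cell_left: "w \<in> weyl G B N \<Longrightarrow> b \<in> B \<Longrightarrow> x \<in> cell w \<Longrightarrow> b \<otimes> x \<in> cell w"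
proof -
  assume w: "w \<in> weyl G B N" "b \<in> B" "x \<in> cell w"
  obtain n where n: "n \<in> w" "n \<in> carrier G" using weyl_nonempty w by blast
  then obtain c c' where c: "c \<in> B" "c' \<in> B" "x = c \<otimes> n \<otimes> c'" using w cell_eq_dc by (auto simp: dc_def)
  then have "b \<otimes> x = (b \<otimes> c) \<otimes> n \<otimes> c'" "b \<otimes> c \<in> B" using n w by (auto simp: m_assoc)
  then have "b \<otimes> x \<in> dc n" unfolding dc_def using c by blast
  then show ?thesis using cell_eq_dc w n by blast
qed

lemma cell_right: "w \<in> weyl G B N \<Longrightarrow> b \<in> B \<Longrightarrow> x \<in> cell w \<Longrightarrow> x \<otimes> b \<in> cell w"
proof -
  assume w: "w \<in> weyl G B N" "b \<in> B" "x \<in> cell w"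
  obtain n where n: "n \<in> w" "n \<in> carrier G" using weyl_nonempty w by blast
  then obtain c c' where c: "c \<in> B" "c' \<in> B" "x = c \<otimes> n \<otimes> c'" using w cell_eq_dc by (auto simp: dc_def)
  then have "x \<otimes> b = c \<otimes> n \<otimes> (c' \<otimes> b)" "c' \<otimes> b \<in> B" using n w by (auto simp: m_assoc)
  then have "x \<otimes> b \<in> dc n" unfolding dc_def using c by blast
  then show ?thesis using cell_eq_dc w n by blast
qed

lemma cell_rep: "w \<in> weyl G B N \<Longrightarrow> n \<in> w \<Longrightarrow> n \<in> cell w"
  using cell_eq_dc dc_self weyl_memD by blast

lemma cell_one: "cell H = B"
proof -
  have "cell H = dc \<one>" by (rule cell_eq_dc [OF H_in_weyl one_in_H])
  also have "\<dots> = B"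
  proof (intro equalityI subsetI)
    fix x assume "x \<in> B"
    then have "x = x \<otimes> \<one> \<otimes> \<one>" by simp
    then show "x \<in> dc \<one>" using \<open>x \<in> B\<close> B.one_closed unfolding dc_def by blast
  qed (auto simp: dc_def)
  finally show ?thesis .
qed

lemma cell_mult:
  assumes "i \<in> {1..r}" "w \<in> weyl G B N" "x \<in> cell (s i)" "y \<in> cell w"
  shows "x \<otimes> y \<in> cell w \<or> x \<otimes> y \<in> cell (s i <#> w)"
proof -
  have si: "s i \<in> weyl G B N" using gen_in_weyl assms by blast
  obtain m n where m: "m \<in> s i" "m \<in> carrier G" and n: "n \<in> w" "n \<in> carrier G"
    using weyl_nonempty si assms(2) by metis
  obtain b1 b2 where b: "b1 \<in> B" "b2 \<in> B" "x = b1 \<otimes> m \<otimes> b2"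
    using cell_eq_dc [OF si m(1)] assms(3) by (auto simp: dc_def)
  obtain b3 b4 where c: "b3 \<in> B" "b4 \<in> B" "y = b3 \<otimes> n \<otimes> b4"
    using cell_eq_dc [OF assms(2) n(1)] assms(4) by (auto simp: dc_def)
  let ?z = "m \<otimes> (b2 \<otimes> b3) \<otimes> n"
  have "?z \<in> s i <#> B <#> w" using m n b c by (auto simp: set_mult_def)
  then have "?z \<in> cell w \<union> cell (s i <#> w)" using BN_axiom [OF assms(1,2)] by (auto simp: cell_def)
  moreover have "b1 \<otimes> ?z \<otimes> b4 \<in> cell v" if "?z \<in> cell v" "v \<in> weyl G B N" for v
    using cell_right [OF that(2) c(2) cell_left [OF that(2) b(1) that(1)]] .
  ultimately have "b1 \<otimes> ?z \<otimes> b4 \<in> cell w \<union> cell (s i <#> w)"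
    using assms(2) weyl_mult [OF si assms(2)] by blast
  moreover have "b1 \<otimes> ?z \<otimes> b4 = x \<otimes> y" using b c m n by (simp add: m_assoc)
  ultimately show ?thesis by auto
qed

lemma Wg_inv: "w \<in> weyl G B N \<Longrightarrow> inv\<^bsub>Wg\<^esub> w = set_inv w"
proof -
  assume w: "w \<in> weyl G B N"
  then have "inv\<^bsub>Wg\<^esub> w = set_inv\<^bsub>G\<lparr>carrier := N\<rparr>\<^esub> w"
    by (intro H.inv_FactGroup) simp
  also have "\<dots> = set_inv w"
    using weyl_coset [OF w] m_inv_consistent [OF N_subgroup] by (auto simp: SET_INV_def)
  finally show ?thesis .
qed

lemma cell_inv: "w \<in> weyl G B N \<Longrightarrow> x \<in> cell w \<Longrightarrow> inv x \<in> cell (inv\<^bsub>Wg\<^esub> w)"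
proof -
  assume w: "w \<in> weyl G B N" "x \<in> cell w"
  obtain n where n: "n \<in> w" "n \<in> carrier G" using weyl_nonempty w by blast
  then obtain c c' where c: "c \<in> B" "c' \<in> B" "x = c \<otimes> n \<otimes> c'" using w cell_eq_dc by (auto simp: dc_def)
  have "inv x = inv c' \<otimes> inv n \<otimes> inv c" using c n by (simp add: inv_mult_group m_assoc)
  then have "inv x \<in> dc (inv n)" unfolding dc_def using c by blast
  moreover have "inv n \<in> inv\<^bsub>Wg\<^esub> w" using n by (auto simp: Wg_inv [OF w(1)] SET_INV_def)
  moreover have "inv\<^bsub>Wg\<^esub> w \<in> weyl G B N" using W.inv_closed [of w] w by simp
  ultimately show ?thesis using cell_eq_dc by blast
qed

text \<open>The union of all cells contains \<open>\<one>\<close> and is closed under left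
  multiplication by \<open>B\<close> and \<open>N\<close>, hence by the group they generate.\<close>

lemma cell_cover:
  assumes "x \<in> carrier G"
  obtains w where "w \<in> weyl G B N" "x \<in> cell w"
proof -
  define X where "X = (\<Union>w\<in>weyl G B N. cell w)"
  have XG: "X \<subseteq> carrier G" using cell_carrier by (auto simp: X_def)
  have B: "b \<otimes> x \<in> X" if "b \<in> B" "x \<in> X" for b x
    using that cell_left by (auto simp: X_def)
  \<comment> \<open>An element of \<open>N\<close> is a product of representatives of simple
    reflections and an element of the torus; \<open>cell_mult\<close> handles one reflection at a
    time.\<close>
  have wp: "n \<otimes> x \<in> X" if "set ws \<subseteq> {1..r}" "n \<in> wprod G H s ws" "x \<in> X" for ws n x
    using that
  proof (induction ws arbitrary: n)
    case Nil
    then show ?case using B H_subset by (auto simp: wprod_def)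
  next
    case (Cons i ws)
    then have i: "i \<in> {1..r}" by simp
    obtain m n' where m: "m \<in> s i" "n' \<in> wprod G H s ws" "n = m \<otimes> n'"
      using Cons.prems(2) by (auto simp: wprod_def set_mult_def)
    have "wprod G H s ws \<in> weyl G B N"
      using W.word_closed [of ws] Cons.prems(1) by (simp add: word_wprod)
    then have G: "m \<in> carrier G" "n' \<in> carrier G" "x \<in> carrier G"
      using m gen_in_weyl [OF i] weyl_memD XG Cons.prems(3) by auto
    have "n' \<otimes> x \<in> X" using Cons m by simp
    then obtain w where "w \<in> weyl G B N" "n' \<otimes> x \<in> cell w" by (auto simp: X_def)
    then have "m \<otimes> (n' \<otimes> x) \<in> X"
      using cell_mult [OF i, of w m "n' \<otimes> x"] cell_rep [OF gen_in_weyl [OF i] m(1)]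
        weyl_mult gen_in_weyl [OF i] by (auto simp: X_def)
    then show ?case using m G by (simp add: m_assoc)
  qed
  have N: "n \<otimes> x \<in> X" if "n \<in> N" "x \<in> X" for n x
    using wp [OF _ _ that(2), of _ n] weyl_generated coset_in_weyl [OF that(1)] by blast
  have "y \<otimes> x \<in> X" if "y \<in> generate G (B \<union> N)" "x \<in> X" for y x
    using that
  proof (induction arbitrary: x rule: generate.induct)
    case one
    then show ?case using XG by auto
  next
    case (incl h)
    then show ?case using B N by blast
  next
    case (inv h)
    then show ?case using B N B.m_inv_closed N.m_inv_closed by blast
  next
    case (eng h1 h2)
    then have "h1 \<in> carrier G" "h2 \<in> carrier G" "x \<in> carrier G" using generate_BN XG by auto
    then show ?case using eng by (simp add: m_assoc)
  qed
  moreover have "\<one> \<in> X"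
    unfolding X_def using cell_one B.one_closed by (intro UN_I [OF H_in_weyl]) simp
  moreover have "x \<in> generate G (B \<union> N)" using assms generate_BN by simp
  ultimately have "x \<otimes> \<one> \<in> X" by blast
  then have "x \<in> X" using assms by simp
  then show ?thesis using that unfolding X_def by blast
qed

text \<open>Left multiplication by a representative of the first letter \<open>s i\<close> of
  \<open>w\<close> leads to the cell of the shorter \<open>u\<close> and, by
  \<open>cell_mult\<close>, to that of \<open>w'\<close> or of \<open>s i <#> w'\<close>. The
  induction hypothesis then identifies \<open>u\<close> with one of these.\<close>

lemma cell_unique_aux:
  assumes "w \<in> weyl G B N" "w' \<in> weyl G B N" "x \<in> cell w" "x \<in> cell w'"
    and "W.len {1..r} w \<le> W.len {1..r} w'"
  shows "w = w'"
  using assms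
proof (induction "W.len {1..r} w" arbitrary: w w' x)
  case 0
  then have w: "w = H" using W.len_eq_0 [of w "{1..r}"] W.para_I by simp
  obtain n where n: "n \<in> w'" "n \<in> N" "n \<in> carrier G" using weyl_nonempty 0 by blast
  have "x \<in> B" using 0 w cell_one by simp
  then have "dc x = B"
    using cell_one cell_eq_dc [OF H_in_weyl one_in_H] dc_eq [OF one_closed, of x] by simp
  moreover have "dc x = dc n"
    using cell_eq_dc [OF 0(3) n(1)] dc_eq [OF n(3), of x] 0(5) by simp
  \<comment> \<open>The representative \<open>n\<close> of \<open>w'\<close> lies in both
    \<open>B\<close> and \<open>N\<close>, hence in the torus, so \<open>w'\<close> is
    trivial.\<close>
  ultimately have "n \<in> H" using dc_self [OF n(3)] n(2) by (auto simp: torus_def)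
  then have "H #> n = H"
    using coset_join2 [OF n(3) H_subgroup] by simp
  then show ?case using weyl_coset [of w' n] 0 n w by simp
next
  case (Suc k)
  have "w \<noteq> H" using Suc.hyps(2) W.len_one [of "{1..r}"] by auto
  then obtain i u where i: "i \<in> {1..r}" "u \<in> weyl G B N" "w = s i <#> u"
      "W.len {1..r} w = Suc (W.len {1..r} u)"
    using W.len_split_left [of "{1..r}" w] Suc.prems W.para_I by auto
  have si: "s i \<in> weyl G B N" using gen_in_weyl i by blast
  obtain m n where m: "m \<in> s i" "m \<in> carrier G" and n: "n \<in> u" "n \<in> carrier G"
    using weyl_nonempty si i(2) by metis
  have mn: "m \<otimes> n \<in> w" using m n i by (auto simp: set_mult_def)
  obtain n' where n': "n' \<in> w'" "n' \<in> carrier G" using weyl_nonempty Suc.prems by blast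
  have "cell w = dc x"
    using cell_eq_dc [OF Suc.prems(1) mn] dc_eq [of "m \<otimes> n" x] m n Suc.prems(3) by simp
  also have "\<dots> = cell w'"
    using cell_eq_dc [OF Suc.prems(2) n'(1)] dc_eq [OF n'(2), of x] Suc.prems(4) by simp
  finally have "m \<otimes> n \<in> cell w'" using cell_rep [OF Suc.prems(1) mn] by simp
  then have "m \<otimes> (m \<otimes> n) \<in> cell w' \<or> m \<otimes> (m \<otimes> n) \<in> cell (s i <#> w')"
    using cell_mult [OF i(1) Suc.prems(2)] cell_rep [OF si m(1)] by blast
  moreover have "m \<otimes> (m \<otimes> n) \<in> s i <#> w" using m mn by (auto simp: set_mult_def)
  then have "m \<otimes> (m \<otimes> n) \<in> u" using W.s_cancel [OF i(1), of u] i by simp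
  then have mu: "m \<otimes> (m \<otimes> n) \<in> cell u" using cell_rep i by blast
  have len: "W.len {1..r} w' \<le> Suc (W.len {1..r} (s i <#> w'))"
    using W.len_s_ge [of "{1..r}" i w'] i(1) Suc.prems(2) W.para_I by simp
  ultimately show ?case
  proof (elim disjE)
    \<comment> \<open>Here \<open>w'\<close> would be as short as \<open>u\<close>, contradicting
      that \<open>w\<close> is at most as long as \<open>w'\<close>.\<close>
    assume "m \<otimes> (m \<otimes> n) \<in> cell w'"
    then have "u = w'" using Suc.hyps(1) [of u w'] Suc.hyps(2) i Suc.prems mu by simp
    then show ?thesis using i Suc.prems by simp
  next
    assume "m \<otimes> (m \<otimes> n) \<in> cell (s i <#> w')"
    then have "u = s i <#> w'"
      using Suc.hyps(1) [of u "s i <#> w'"] Suc.hyps(2) i Suc.prems mu weyl_mult [OF si] len by simp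
    then show ?thesis using i W.s_cancel [OF i(1), of w'] Suc.prems by simp
  qed
qed

lemma cell_unique:
  assumes "w \<in> weyl G B N" "w' \<in> weyl G B N" "x \<in> cell w" "x \<in> cell w'"
  shows "w = w'"
  using cell_unique_aux [OF assms] cell_unique_aux [OF assms(2,1,4,3)]
    nat_le_linear by metis

section \<open>The Weyl distance on cosets and the building axioms\<close>

definition dist :: "'a set \<Rightarrow> 'a set \<Rightarrow> 'a set" where
  "dist C C' = (THE w. w \<in> weyl G B N \<and> C' \<subseteq> B <#> w <#> B <#> C)"

lemma coset_subset_iff:
  assumes "w \<in> weyl G B N" "g \<in> carrier G" "g' \<in> carrier G"
  shows "B #> g' \<subseteq> B <#> w <#> B <#> (B #> g) \<longleftrightarrow> g' \<otimes> inv g \<in> cell w"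
proof
  assume "B #> g' \<subseteq> B <#> w <#> B <#> (B #> g)"
  then have "g' \<in> cell w <#> (B #> g)"
    using rcos_self [OF assms(3) B_subgroup] by (auto simp: cell_def)
  then obtain d b where d: "d \<in> cell w" "b \<in> B" "g' = d \<otimes> (b \<otimes> g)"
    by (auto simp: set_mult_def r_coset_def)
  then have "g' \<otimes> inv g = d \<otimes> b" using assms cell_carrier [of w d] by (simp add: m_assoc)
  then show "g' \<otimes> inv g \<in> cell w" using cell_right d assms by simp
next
  assume d: "g' \<otimes> inv g \<in> cell w"
  show "B #> g' \<subseteq> B <#> w <#> B <#> (B #> g)"
  proof
    fix x assume "x \<in> B #> g'"
    then obtain b where b: "b \<in> B" "x = b \<otimes> g'" by (auto simp: r_coset_def)
    then have "x = (b \<otimes> (g' \<otimes> inv g)) \<otimes> g" using assms by (simp add: m_assoc)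
    moreover have "b \<otimes> (g' \<otimes> inv g) \<in> cell w" using cell_left b d assms by blast
    moreover have "g \<in> B #> g" by (rule rcos_self [OF assms(2) B_subgroup])
    ultimately show "x \<in> B <#> w <#> B <#> (B #> g)"
      unfolding cell_def [symmetric] by (auto simp: set_mult_def)
  qed
qed

lemma dist_eq_iff:
  assumes "g \<in> carrier G" "g' \<in> carrier G"
  shows "dist (B #> g) (B #> g') \<in> weyl G B N"
    and "w \<in> weyl G B N \<Longrightarrow> dist (B #> g) (B #> g') = w \<longleftrightarrow> g' \<otimes> inv g \<in> cell w"
proof -
  obtain v where v: "v \<in> weyl G B N" "g' \<otimes> inv g \<in> cell v"
    using cell_cover [of "g' \<otimes> inv g"] assms by auto
  have "dist (B #> g) (B #> g') = v"
    unfolding dist_def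
  proof (rule the_equality)
    fix w assume "w \<in> weyl G B N \<and> B #> g' \<subseteq> B <#> w <#> B <#> (B #> g)"
    then show "w = v" using coset_subset_iff assms v cell_unique by blast
  qed (use v coset_subset_iff assms in blast)
  then show "dist (B #> g) (B #> g') \<in> weyl G B N"
    and "w \<in> weyl G B N \<Longrightarrow> dist (B #> g) (B #> g') = w \<longleftrightarrow> g' \<otimes> inv g \<in> cell w"
    using v cell_unique by blast+
qed

lemma rcosetsE:
  assumes "C \<in> rcosets B"
  obtains g where "g \<in> carrier G" "C = B #> g"
  using assms by (auto simp: RCOSETS_def)

text \<open>The right-hand side is the summation condition in \<open>hecke_act\<close>, which
  thereby becomes the operator \<open>T\<close> of the building.\<close>

lemma dist_eq_subset_iff:
  assumes "C \<in> rcosets B" "C' \<in> rcosets B" "w \<in> weyl G B N"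
  shows "dist C C' = w \<longleftrightarrow> C' \<subseteq> B <#> w <#> B <#> C"
proof -
  obtain g h where "g \<in> carrier G" "C = B #> g" "h \<in> carrier G" "C' = B #> h"
    using assms(1,2) by (elim rcosetsE)
  then show ?thesis
    using coset_subset_iff [OF assms(3)] dist_eq_iff(2) [OF _ _ assms(3)] by simp
qed

text \<open>The cosets in question partition the translate \<open>cell (s i) #> g\<close>, of size
  \<open>q * card B\<close>, into sets of size \<open>card B\<close>.\<close>

lemma panel:
  assumes "C \<in> rcosets B" "i \<in> {1..r}"
  shows "card {C' \<in> rcosets B. dist C C' = s i} = q"
proof -
  obtain g where g: "g \<in> carrier G" "C = B #> g" using assms by (elim rcosetsE)
  have si: "s i \<in> weyl G B N" using gen_in_weyl assms by blast
  have DG: "cell (s i) \<subseteq> carrier G" using cell_carrier si by blast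
  let ?Z = "{C' \<in> rcosets B. dist C C' = s i}"
  have fin: "finite (rcosets B)"
    using finite_G by (simp add: RCOSETS_def)
  have "\<Union>?Z = cell (s i) #> g"
  proof (intro equalityI subsetI)
    fix x assume "x \<in> \<Union>?Z"
    then obtain C' where C': "C' \<in> rcosets B" "dist C C' = s i" "x \<in> C'" by blast
    have x: "x \<in> carrier G" using C' B.rcosets_carrier group_axioms by blast
    have "C' = B #> x"
      using C'(1,3) x by (metis B_subgroup rcosetsE repr_independence)
    then have "x \<otimes> inv g \<in> cell (s i)" using C'(2) dist_eq_iff(2) [OF g(1) x si] g by simp
    moreover have "x = (x \<otimes> inv g) \<otimes> g" using x g by (simp add: m_assoc)
    ultimately show "x \<in> cell (s i) #> g" unfolding r_coset_def by blast
  next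
    fix x assume "x \<in> cell (s i) #> g"
    then obtain d where d: "d \<in> cell (s i)" "x = d \<otimes> g" by (auto simp: r_coset_def)
    then have x: "x \<in> carrier G" "x \<otimes> inv g = d" using DG g by (auto simp: m_assoc subset_iff)
    then have "dist C (B #> x) = s i" using dist_eq_iff(2) [OF g(1) x(1) si] g d by simp
    moreover have "B #> x \<in> rcosets B" "x \<in> B #> x"
      using x rcosetsI [of B x] rcos_self [OF x(1) B_subgroup] B.subset by auto
    ultimately show "x \<in> \<Union>?Z" by blast
  qed
  moreover have "card B * card ?Z = card (\<Union>?Z)"
  proof (rule card_partition)
    show "finite ?Z" using fin by simp
    have "\<Union>?Z \<subseteq> carrier G" using B.rcosets_carrier group_axioms by blast
    then show "finite (\<Union>?Z)" using finite_G finite_subset by blast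
    show "card C' = card B" if "C' \<in> ?Z" for C'
      using that card_cosets_equal [of C' B] B.subset bij_betw_same_card by (metis mem_Collect_eq)
    show "C1 \<inter> C2 = {}" if "C1 \<in> ?Z" "C2 \<in> ?Z" "C1 \<noteq> C2" for C1 C2
      using that rcos_disjoint [OF B_subgroup] by (auto simp: pairwise_def disjnt_def)
  qed
  moreover have "card (cell (s i) #> g) = card (cell (s i))"
    using card_cosets_equal [OF rcosetsI [OF DG g(1)] DG] bij_betw_same_card by metis
  moreover have "card (cell (s i)) = q * card B" using panel_size assms by (simp add: cell_def)
  moreover have "card B > 0" using finite_G B.subset B.one_closed card_gt_0_iff finite_subset by blast
  ultimately show ?thesis by (simp add: mult.commute)
qed

lemma building_axioms: "building Wg {1..r} s (rcosets B) dist q"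
proof (intro building.intro building_axioms.intro)
  show "involution_generated Wg {1..r} s" by (rule W.involution_generated_axioms)
  show "finite (rcosets B)" using finite_G by (simp add: RCOSETS_def)
  show "rcosets B \<noteq> {}" using rcosetsI [of B \<one>] B.subset by auto
  show "2 \<le> q" by (rule thick)
  show "s i \<noteq> \<one>\<^bsub>Wg\<^esub>" if "i \<in> {1..r}" for i using gen_ne_one that by simp
  show "card {z \<in> rcosets B. dist y z = s i} = q" if "y \<in> rcosets B" "i \<in> {1..r}" for y i
    using panel that .
  fix x y assume "x \<in> rcosets B" "y \<in> rcosets B"
  then obtain g h where g: "g \<in> carrier G" "x = B #> g" and h: "h \<in> carrier G" "y = B #> h"
    by (elim rcosetsE)
  have d: "dist x y \<in> weyl G B N" "h \<otimes> inv g \<in> cell (dist x y)"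
    using dist_eq_iff [OF g(1) h(1)] g h by auto
  then show "dist x y \<in> carrier Wg" by simp
  have "dist x y = H \<longleftrightarrow> h \<otimes> inv g \<in> B"
    using dist_eq_iff(2) [OF g(1) h(1), of H] g h cell_one W.one_closed by simp
  also have "\<dots> \<longleftrightarrow> h \<in> B #> g"
    using B.rcos_module [OF group_axioms g(1) h(1)] by simp
  also have "\<dots> \<longleftrightarrow> x = y"
    using g h repr_independence [OF _ g(1) B_subgroup, of h] rcos_self [OF h(1) B_subgroup] by auto
  finally show "dist x y = \<one>\<^bsub>Wg\<^esub> \<longleftrightarrow> x = y" by simp
  have "inv (h \<otimes> inv g) = g \<otimes> inv h" using g h by (simp add: inv_mult_group)
  then have "g \<otimes> inv h \<in> cell (inv\<^bsub>Wg\<^esub> (dist x y))" using cell_inv [OF d] by simp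
  then show "dist y x = inv\<^bsub>Wg\<^esub> (dist x y)"
    using dist_eq_iff(2) [OF h(1) g(1), of "inv\<^bsub>Wg\<^esub> (dist x y)"] W.inv_closed [of "dist x y"] d g h
    by simp
  fix i assume i: "i \<in> {1..r}"
  have si: "s i \<in> weyl G B N" using gen_in_weyl i by blast
  show "\<exists>z\<in>rcosets B. dist y z = s i \<and> dist x z = s i \<otimes>\<^bsub>Wg\<^esub> dist x y"
  proof -
    obtain m n where m: "m \<in> s i" "m \<in> carrier G" and n: "n \<in> dist x y" "n \<in> carrier G"
      using weyl_nonempty si d(1) by metis
    obtain b b' where b: "b \<in> B" "b' \<in> B" "h \<otimes> inv g = b \<otimes> n \<otimes> b'"
      using d(2) cell_eq_dc [OF d(1) n(1)] by (auto simp: dc_def)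
    \<comment> \<open>This choice makes \<open>k \<otimes> inv h = m \<otimes> inv b\<close> and
      \<open>k \<otimes> inv g = m \<otimes> n \<otimes> b'\<close>, which lie in the cells of
      \<open>s i\<close> and of \<open>s i <#> dist x y\<close>.\<close>
    define k where "k = m \<otimes> (inv b \<otimes> h)"
    have k: "k \<in> carrier G" using m b h by (simp add: k_def)
    have "k \<otimes> inv h = m \<otimes> inv b" using m b h by (simp add: k_def m_assoc)
    then have "k \<otimes> inv h \<in> cell (s i)" using cell_right [OF si _ cell_rep [OF si m(1)]] b by simp
    moreover have "k \<otimes> inv g = m \<otimes> (inv b \<otimes> (h \<otimes> inv g))"
      using m b h g by (simp add: k_def m_assoc)
    then have "k \<otimes> inv g = (m \<otimes> n) \<otimes> b'"
      unfolding b(3) using m n b by (simp add: m_assoc) (simp add: m_assoc [symmetric])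
    then have "k \<otimes> inv g \<in> cell (s i <#> dist x y)"
      using cell_right [OF weyl_mult [OF si d(1)] b(2) cell_rep [OF weyl_mult [OF si d(1)]]] m n
      by (auto simp: set_mult_def)
    ultimately show ?thesis
      using dist_eq_iff(2) [OF h(1) k si] dist_eq_iff(2) [OF g(1) k weyl_mult [OF si d(1)]]
        rcosetsI [OF B.subset k] g h by auto
  qed
  fix z assume "z \<in> rcosets B" and yz: "dist y z = s i"
  then obtain k where k: "k \<in> carrier G" "z = B #> k" by (elim rcosetsE)
  have "k \<otimes> inv h \<in> cell (s i)" using dist_eq_iff(2) [OF h(1) k(1) si] yz h k by simp
  moreover have "k \<otimes> inv g = (k \<otimes> inv h) \<otimes> (h \<otimes> inv g)"
    using g h k by (simp add: m_assoc) (simp add: m_assoc [symmetric])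
  ultimately have "k \<otimes> inv g \<in> cell (dist x y) \<or> k \<otimes> inv g \<in> cell (s i <#> dist x y)"
    using cell_mult [OF i d(1) _ d(2)] by simp
  then show "dist x z = dist x y \<or> dist x z = s i \<otimes>\<^bsub>Wg\<^esub> dist x y"
    using dist_eq_iff(2) [OF g(1) k(1)] d(1) weyl_mult [OF si d(1)] g k by auto
qed

end

section \<open>Composition series of the permutation module\<close>

text \<open>A proper nonempty initial part of the composition has a positive sum and leaves a
  positive remainder of \<open>r + 1\<close>.\<close>

lemma comp_descents_subset:
  assumes "is_composition \<alpha> (r + 1)"
  shows "comp_descents \<alpha> \<subseteq> {1..r}"
proof
  fix d assume "d \<in> comp_descents \<alpha>"
  then obtain k where k: "1 \<le> k" "k < length \<alpha>" "d = sum_list (take k \<alpha>)"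
    by (auto simp: comp_descents_def)
  have pos: "0 < sum_list xs" if "set xs \<subseteq> set \<alpha>" "xs \<noteq> []" for xs
    using that assms by (cases xs) (auto simp: is_composition_def)
  have "0 < d" unfolding k(3) using k by (intro pos) (auto dest: in_set_takeD)
  moreover have "0 < sum_list (drop k \<alpha>)" using k by (intro pos) (auto dest: in_set_dropD)
  moreover have "d + sum_list (drop k \<alpha>) = r + 1"
    using assms k(3) by (metis append_take_drop_id is_composition_def sum_list_append)
  ultimately show "d \<in> {1..r}" by auto
qed

locale BN_pair_char = BN_pair G B N s r q
  for G :: "('a, 'b) monoid_scheme" (structure) and B N :: "'a set" and s :: "nat \<Rightarrow> 'a set"
    and r q :: nat +
  fixes scalars :: "'f::field itself"
  assumes q_zero: "of_nat q = (0::'f)"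
begin

declare One_nat_def [simp del]
  \<comment> \<open>otherwise the parameter \<open>{1..r}\<close> of the constants inherited from \<open>M\<close> is rewritten\<close>

sublocale M: hecke_building Wg "{1..r}" s "rcosets B" dist q scalars
  by (intro hecke_building.intro hecke_building_axioms.intro building_axioms q_zero)

lemma permmod_eq: "(permmod G B :: ('a set \<Rightarrow> 'f) set) = M.space"
  by (simp add: permmod_def M.space_def)

lemma hecke_act_eq:
  assumes "w \<in> weyl G B N"
  shows "hecke_act G B w (v :: 'a set \<Rightarrow> 'f) = M.T w v"
proof
  fix C'
  show "hecke_act G B w v C' = M.T w v C'"
  proof (cases "C' \<in> rcosets B")
    case True
    then have "hecke_act G B w v C' = (\<Sum>C\<in>rcosets B. if dist C C' = w then v C else 0)"
      using dist_eq_subset_iff [OF _ _ assms] by (auto simp: hecke_act_def intro!: sum.cong)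
    also have "\<dots> = (\<Sum>C | C \<in> rcosets B \<and> dist C C' = w. v C)"
      using M.finite_chambers by (simp add: sum.inter_filter)
    finally show ?thesis using True by (simp add: M.T_def)
  qed (simp add: hecke_act_def M.T_def)
qed

lemma hsubmod_eq: "hsubmod G B s r (U :: ('a set \<Rightarrow> 'f) set) \<longleftrightarrow> M.stable U"
  using gen_in_weyl by (simp add: hsubmod_def M.stable_def permmod_eq hecke_act_eq)

lemma factor_iso_C_eq: "factor_iso_C G B s r (U :: ('a set \<Rightarrow> 'f) set) V E \<longleftrightarrow> M.factor U V E"
proof -
  have "(\<forall>i\<in>{1..r}. \<forall>v\<in>V. (\<lambda>C. hecke_act G B (s i) v C - (if i \<in> E then - 1 else 0) * v C) \<in> U)
      \<longleftrightarrow> (\<forall>v\<in>V. M.eigen_mod U E v)"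
    using hecke_act_eq [OF gen_in_weyl] unfolding M.eigen_mod_def by auto
  then show ?thesis unfolding factor_iso_C_def M.factor_def M.adjoin_def by simp
qed

text \<open>Inversion preserves length and turns right multiplication of \<open>w^-1\<close> by
  \<open>s i\<close> into left multiplication of \<open>w\<close>.\<close>

lemma descents_eq:
  assumes "w \<in> weyl G B N"
  shows "descents G H s r (set_inv w) = M.descent_set w"
proof -
  have "wlen G H s r (set_inv w <#> s i) = M.ell (s i <#> w)" if "i \<in> {1..r}" for i
  proof -
    have "inv\<^bsub>Wg\<^esub> (s i <#> w) = set_inv w <#> s i"
      using W.inv_mult_group [of "s i" w] W.s_inv [OF that] gen_in_weyl [OF that] assms
        Wg_inv [OF assms] by simp
    then show ?thesis
      using W.len_inv [of "s i <#> w"] weyl_mult [OF gen_in_weyl [OF that] assms]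
      by (simp add: len_wlen)
  qed
  moreover have "wlen G H s r (set_inv w) = M.ell w"
    using W.len_inv [of w] Wg_inv [OF assms] assms by (simp add: len_wlen)
  ultimately show ?thesis by (auto simp: descents_def M.descent_set_def)
qed

lemma comp_series_exists: "\<exists>Vs :: ('a set \<Rightarrow> 'f) set list. comp_series G B s r Vs"
proof -
  obtain V E n where V: "M.chain V E n" "V n = M.space" by (rule M.full_chain_exists)
  define Vs where "Vs = map V [0..<Suc n]"
  have len: "length Vs = Suc n" by (simp add: Vs_def)
  have nth: "Vs ! j = V j" if "j \<le> n" for j using that by (simp add: Vs_def del: upt_Suc)
  have "last Vs = V n"
    using len nth [of n]
    by (metis diff_Suc_1 last_conv_nth length_0_conv nat.simps(3) order_refl)
  moreover have "Vs ! (j - 1) \<subset> Vs ! j \<and>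
        (\<forall>U. hsubmod G B s r U \<and> Vs ! (j - 1) \<subseteq> U \<and> U \<subseteq> Vs ! j \<longrightarrow>
             U = Vs ! (j - 1) \<or> U = Vs ! j)" if j: "0 < j \<and> j < length Vs" for j
  proof -
    obtain i where i: "j = Suc i" "i < n" using j len by (cases j) auto
    then have "M.factor (V i) (V j) (E i)" using V(1) by (simp add: M.chain_def)
    then show ?thesis
      using M.factor_psubset M.factor_simple i nth [of i] nth [of j] by (simp add: hsubmod_eq)
  qed
  ultimately have "comp_series G B s r Vs"
    using V len nth by (auto simp: comp_series_def hsubmod_eq permmod_eq M.chain_def)
  then show ?thesis by blast
qed

text \<open>Any composition series is a full chain, with labels supplied by
  \<open>simple_factor\<close>, so \<open>chain_multiplicity\<close> applies to it.\<close>

lemma comp_series_multiplicity: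
  fixes Vs :: "('a set \<Rightarrow> 'f) set list"
  assumes "comp_series G B s r Vs" "E \<subseteq> {1..r}"
  shows "cf_mult G B s r Vs E =
           (\<Sum>w \<in> {w \<in> weyl G B N. descents G H s r (set_inv w) = E}. q ^ wlen G H s r w)"
proof -
  define n where "n = length Vs - 1"
  have len: "length Vs = Suc n" using assms(1) by (cases Vs) (auto simp: comp_series_def n_def)
  have st: "M.stable (Vs ! j)" if "j \<le> n" for j
    using assms(1) that len by (simp add: comp_series_def hsubmod_eq)
  have "\<exists>F. F \<subseteq> {1..r} \<and> M.factor (Vs ! j) (Vs ! Suc j) F" if "j < n" for j
  proof -
    have "Vs ! j \<subset> Vs ! Suc j \<and> (\<forall>U. M.stable U \<and> Vs ! j \<subseteq> U \<and> U \<subseteq> Vs ! Suc j \<longrightarrow>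
             U = Vs ! j \<or> U = Vs ! Suc j)"
      using assms(1) that len unfolding comp_series_def hsubmod_eq
      by (metis Suc_less_eq diff_Suc_1 zero_less_Suc)
    then show ?thesis using M.simple_factor [OF st st, of j "Suc j"] that by (metis Suc_leI less_imp_le)
  qed
  then obtain F where F: "\<And>j. j < n \<Longrightarrow> F j \<subseteq> {1..r} \<and> M.factor (Vs ! j) (Vs ! Suc j) (F j)"
    by metis
  have chain: "M.chain ((!) Vs) F n"
    using F st assms(1) by (simp add: M.chain_def comp_series_def)
  have "Vs ! n = M.space"
    using assms(1) len last_conv_nth [of Vs] by (auto simp: comp_series_def permmod_eq)
  \<comment> \<open>Step \<open>j\<close> of the chain is factor \<open>Suc j\<close> of the series,
    hence the shift. Uniqueness of labels turns isomorphism with the module of \<open>E\<close> into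
    \<open>F j = E\<close>.\<close>
  have "{j. 0 < j \<and> j < length Vs \<and> factor_iso_C G B s r (Vs ! (j - 1)) (Vs ! j) E}
      = Suc ` {j. j < n \<and> F j = E}"
  proof (intro equalityI subsetI)
    fix j assume "j \<in> {j. 0 < j \<and> j < length Vs \<and> factor_iso_C G B s r (Vs ! (j - 1)) (Vs ! j) E}"
    then obtain i where i: "j = Suc i" "i < n" "M.factor (Vs ! i) (Vs ! Suc i) E"
      using len by (cases j) (auto simp: factor_iso_C_eq)
    then have "F i = E"
      using M.factor_unique [OF st [of i] _ i(3), of "F i"] F [OF i(2)] assms(2) by simp
    then show "j \<in> Suc ` {j. j < n \<and> F j = E}" using i by blast
  next
    fix j assume "j \<in> Suc ` {j. j < n \<and> F j = E}"
    then show "j \<in> {j. 0 < j \<and> j < length Vs \<and> factor_iso_C G B s r (Vs ! (j - 1)) (Vs ! j) E}"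
      using F len by (auto simp: factor_iso_C_eq)
  qed
  then have "cf_mult G B s r Vs E = card {j. j < n \<and> F j = E}"
    by (simp add: cf_mult_def card_image)
  also have "\<dots> = (\<Sum>w | w \<in> weyl G B N \<and> M.descent_set w = E. q ^ wlen G H s r w)"
    using M.chain_multiplicity [OF chain \<open>Vs ! n = M.space\<close> assms(2)] by (simp add: len_wlen)
  also have "\<dots> = (\<Sum>w \<in> {w \<in> weyl G B N. descents G H s r (set_inv w) = E}. q ^ wlen G H s r w)"
    using descents_eq by (intro sum.cong) auto
  finally show ?thesis .
qed

end

theorem theorem6p4:
  fixes G :: "('a, 'b) monoid_scheme" and B N :: "'a set" and s :: "nat \<Rightarrow> 'a set"
    and r q p k :: nat and \<alpha> :: "nat list"
  assumes "split_BN_pair G B N s r q"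
    and "prime p" and "0 < k" and "q = p ^ k"
    and "CHAR('f::field) = p"
    and "is_composition \<alpha> (r + 1)"
  shows "(\<exists>Vs :: ('a set \<Rightarrow> 'f) set list. comp_series G B s r Vs) \<and>
         (\<forall>Vs :: ('a set \<Rightarrow> 'f) set list. comp_series G B s r Vs \<longrightarrow>
            cf_mult G B s r Vs (comp_descents \<alpha>) =
              (\<Sum>w \<in> {w \<in> weyl G B N.
                        descents G (torus B N) s r (set_inv\<^bsub>G\<^esub> w) = comp_descents \<alpha>}.
                 q ^ wlen G (torus B N) s r w))"
proof -
  \<comment> \<open>The interpretation needs a thick building, \<open>2 \<le> q\<close>, and the
    vanishing of \<open>q\<close> in characteristic \<open>p\<close>; the latter uses
    \<open>0 < k\<close>.\<close>
  have "p \<le> q" using assms(2-4) self_le_power [of p k] prime_ge_2_nat [of p] by simp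
  then have "2 \<le> q" using prime_ge_2_nat [OF assms(2)] by linarith
  moreover have "of_nat q = (0::'f)"
    using assms(3-5) by (simp add: of_nat_eq_0_iff_char_dvd)
  ultimately interpret BN_pair_char G B N s r q "TYPE('f)"
    using assms(1) by unfold_locales
  show ?thesis
    using comp_series_exists comp_series_multiplicity comp_descents_subset [OF assms(6)] by blast
qed

end
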